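(* For any integer $q\ge2$, $\mathrm{QACC}=\mathrm{QACC}[q]$; that is, every operator family in $\mathrm{QACC}$ is $\mathrm{QAC}^0$-reducible to (i.e. can be simulated up to work bits by) a family in $\mathrm{QACC}[q]$, and conversely.
   Context: Gates: one-qubit gates are elements of $U(2)$; for $U\in U(2)$, $\wedge_m(U)$ applies $U$ to the last qubit iff the first $m$ qubits are all $1$; a Toffoli gate is $\wedge_m(X)$, $X=\begin{pmatrix}0&1\\1&0\end{pmatrix}$, $m\ge0$; a controlled-not is $\wedge_1(X)$; a controlled-not layer performs, in one step, controlled-nots between an arbitrary collection of disjoint pairs of lines. For Boolean $y$, $\mathrm{Mod}_q(y_1,\ldots,y_m)=1$ iff $\sum y_i\not\equiv0\pmod q$, and the quantum $\mathrm{MOD}_q$ gate maps $|y_1,\ldots,y_m,x\rangle\mapsto|y_1,\ldots,y_m,x\oplus\mathrm{Mod}_q(y)\rangle$. $\mathrm{QAC}^0$ is the class of families $\{F_n\}$, $F_n\in U(2^{n+p(n)})$ ($p$ a polynomial), each $F_n$ a product of $O(1)$ layers, each layer either a Kronecker product of one-qubit and Toffoli gates or a controlled-not layer, with the number of distinct one-qubit gate types fixed independently of $n$. $\mathrm{QACC}[q]$ is defined the same way but layers may also contain (unbounded fan-in) $\mathrm{MOD}_q$ gates, and $\mathrm{QACC}=\bigcup_q\mathrm{QACC}[q]$. $\{F_n\}$ is $\mathrm{QAC}^0$-reducible to $\{G_n\}$ if there is a family $\{R_n\}$ of $\mathrm{QAC}^0$ operators augmented with operators from $\{G_n\}$ such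 that for all $n$, ${\bf x},{\bf y}\in\{0,1\}^n$ some work-bit setting ${\bf z}\in\{0,1\}^{p(n)}$ gives $\langle{\bf y}|F_n|{\bf x}\rangle=\langle{\bf y},{\bf z}|R_n|{\bf x},{\bf z}\rangle$. Equality of operator classes is understood up to this mutual reducibility. *)

theory Defs
  imports Complex_Main
begin

text \<open>A computational basis state of N qubits (lines 0..N-1) is a bool list of length N.
  An operator on N qubits is given by its matrix entries: op y x = <y|op|x>
  (only entries with length x = length y = N are meaningful).\<close>

type_synonym bstate = "bool list"
type_synonym qop = "bstate \<Rightarrow> bstate \<Rightarrow> complex"
type_synonym qfam = "nat \<Rightarrow> qop"

definition states :: "nat \<Rightarrow> bstate set" where
  "states N = {s. length s = N}"

definition op_id :: qop where
  "op_id y x = (if y = x then 1 else 0)"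

definition op_mult :: "nat \<Rightarrow> qop \<Rightarrow> qop \<Rightarrow> qop" where
  "op_mult N A B y x = (\<Sum>z\<in>states N. A y z * B z x)"

type_synonym mat2 = "bool \<Rightarrow> bool \<Rightarrow> complex"

definition unitary2 :: "mat2 \<Rightarrow> bool" where
  "unitary2 U \<longleftrightarrow> (\<forall>i j. (\<Sum>k\<in>UNIV. cnj (U k i) * U k j) = (if i = j then 1 else 0))"

definition Modq :: "nat \<Rightarrow> bool list \<Rightarrow> bool" where
  "Modq q ys \<longleftrightarrow> length (filter id ys) mod q \<noteq> 0"

datatype gate =
    OneQ mat2 nat
  | Toff "nat list" nat           \<comment> \<open>Toffoli gate wedge_m(X): controls, target (m \<ge> 0)\<close>
  | ModG nat "nat list" nat       \<comment> \<open>MOD_q gate: modulus q, inputs y_1..y_m, target x\<close>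
  | Orc nat "nat list"            \<comment> \<open>oracle gate G_m from a given family, on the given lines\<close>

fun glines :: "gate \<Rightarrow> nat list" where
  "glines (OneQ U i) = [i]"
| "glines (Toff cs t) = cs @ [t]"
| "glines (ModG q ys t) = ys @ [t]"
| "glines (Orc m ls) = ls"

definition perm_mat :: "(bool list \<Rightarrow> bool list) \<Rightarrow> qop" where
  "perm_mat f out inp = (if out = f inp then 1 else 0)"

definition toff_fun :: "bool list \<Rightarrow> bool list" where
  "toff_fun b = butlast b @ [last b \<noteq> (\<forall>c\<in>set (butlast b). c)]"

definition mod_fun :: "nat \<Rightarrow> bool list \<Rightarrow> bool list" where
  "mod_fun q b = butlast b @ [last b \<noteq> Modq q (butlast b)]"

text \<open>Local matrix of a gate on the bits of its own lines (in the order of glines);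
  oracle gates take their matrix from the oracle family G.\<close>
fun gmat :: "qfam \<Rightarrow> gate \<Rightarrow> qop" where
  "gmat G (OneQ U i) out inp = U (hd out) (hd inp)"
| "gmat G (Toff cs t) out inp = perm_mat toff_fun out inp"
| "gmat G (ModG q ys t) out inp = perm_mat (mod_fun q) out inp"
| "gmat G (Orc m ls) out inp = G m out inp"

text \<open>Well-formedness of a gate in a circuit of width N, where wG m is the number of
  qubits the oracle operator G_m acts on.\<close>
definition gate_wf :: "(nat \<Rightarrow> nat) \<Rightarrow> nat \<Rightarrow> gate \<Rightarrow> bool" where
  "gate_wf wG N g \<longleftrightarrow> distinct (glines g) \<and> (\<forall>i\<in>set (glines g). i < N)
     \<and> (case g of OneQ U i \<Rightarrow> unitary2 U | Orc m ls \<Rightarrow> length ls = wG m | _ \<Rightarrow> True)"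

datatype layer =
    GLayer "gate list"              \<comment> \<open>tensor (Kronecker) product of gates on disjoint lines\<close>
  | CnotLayer "(nat \<times> nat) list"    \<comment> \<open>controlled-nots on disjoint pairs (control, target)\<close>

fun layer_gates :: "layer \<Rightarrow> gate list" where
  "layer_gates (GLayer gs) = gs"
| "layer_gates (CnotLayer ps) = map (\<lambda>(c, t). Toff [c] t) ps"

definition layer_wf :: "(nat \<Rightarrow> nat) \<Rightarrow> nat \<Rightarrow> layer \<Rightarrow> bool" where
  "layer_wf wG N L \<longleftrightarrow> (let gs = layer_gates L in
     (\<forall>g\<in>set gs. gate_wf wG N g) \<and>
     (\<forall>i<length gs. \<forall>j<length gs. i \<noteq> j \<longrightarrow> set (glines (gs!i)) \<inter> set (glines (gs!j)) = {}))"

definition layer_mat :: "qfam \<Rightarrow> nat \<Rightarrow> layer \<Rightarrow> qop" where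
  "layer_mat G N L y x =
     (let gs = layer_gates L in
      (\<Prod>g\<leftarrow>gs. gmat G g (map ((!) y) (glines g)) (map ((!) x) (glines g))) *
      (if \<forall>i<N. (\<forall>g\<in>set gs. i \<notin> set (glines g)) \<longrightarrow> y!i = x!i then 1 else 0))"

fun circ_mat :: "qfam \<Rightarrow> nat \<Rightarrow> layer list \<Rightarrow> qop" where
  "circ_mat G N [] = op_id"
| "circ_mat G N (L # Ls) = op_mult N (circ_mat G N Ls) (layer_mat G N L)"

definition poly_bounded :: "(nat \<Rightarrow> nat) \<Rightarrow> bool" where
  "poly_bounded a \<longleftrightarrow> (\<exists>c k. \<forall>n. a n \<le> c * n ^ k + c)"

definition circ_ok :: "(gate \<Rightarrow> bool) \<Rightarrow> (nat \<Rightarrow> nat) \<Rightarrow> nat \<Rightarrow> nat \<Rightarrow> mat2 set \<Rightarrow> layer list \<Rightarrow> bool" where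
  "circ_ok ok wG N d S C \<longleftrightarrow> length C \<le> d \<and>
     (\<forall>L\<in>set C. layer_wf wG N L \<and>
        (\<forall>g\<in>set (layer_gates L). ok g \<and> (\<forall>U i. g = OneQ U i \<longrightarrow> U \<in> S)))"

definition qac0_gate :: "gate \<Rightarrow> bool" where
  "qac0_gate g \<longleftrightarrow> (case g of OneQ U i \<Rightarrow> True | Toff cs t \<Rightarrow> True | _ \<Rightarrow> False)"

definition qaccq_gate :: "nat \<Rightarrow> gate \<Rightarrow> bool" where
  "qaccq_gate q g \<longleftrightarrow> qac0_gate g \<or> (\<exists>ys t. g = ModG q ys t)"

definition circ_class :: "(gate \<Rightarrow> bool) \<Rightarrow> (nat \<Rightarrow> nat) \<Rightarrow> qfam \<Rightarrow> bool" where
  "circ_class ok w F \<longleftrightarrow> (\<exists>p d S. poly_bounded p \<and> finite S \<and>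
     (\<forall>n. w n = n + p n \<and>
        (\<exists>C. circ_ok ok (\<lambda>_. 0) (w n) d S C \<and>
             (\<forall>x\<in>states (w n). \<forall>y\<in>states (w n). F n y x = circ_mat (\<lambda>_ _ _. 0) (w n) C y x))))"

definition QAC0 :: "(nat \<Rightarrow> nat) \<Rightarrow> qfam \<Rightarrow> bool" where
  "QAC0 w F \<longleftrightarrow> circ_class qac0_gate w F"

definition QACCq :: "nat \<Rightarrow> (nat \<Rightarrow> nat) \<Rightarrow> qfam \<Rightarrow> bool" where
  "QACCq q w F \<longleftrightarrow> circ_class (qaccq_gate q) w F"

definition QACC :: "(nat \<Rightarrow> nat) \<Rightarrow> qfam \<Rightarrow> bool" where
  "QACC w F \<longleftrightarrow> (\<exists>q\<ge>2. QACCq q w F)"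

text \<open>QAC0-reducibility of (wF,F) to (wG,G): a family of constant-depth circuits with QAC0
  gates and oracle gates G_m (any m), finitely many one-qubit gate types, on wF n + k n
  qubits (k polynomially bounded work bits, placed after F's lines), such that for all
  basis states x, y of F_n some work-bit setting z gives <y|F_n|x> = <y,z|R_n|x,z>.\<close>
definition qac0_reducible :: "(nat \<Rightarrow> nat) \<Rightarrow> qfam \<Rightarrow> (nat \<Rightarrow> nat) \<Rightarrow> qfam \<Rightarrow> bool" where
  "qac0_reducible wF F wG G \<longleftrightarrow> (\<exists>k d S. poly_bounded k \<and> finite S \<and>
     (\<forall>n. \<exists>C. circ_ok (\<lambda>g. qac0_gate g \<or> (\<exists>m ls. g = Orc m ls)) wG (wF n + k n) d S C \<and>
          (\<forall>x\<in>states (wF n). \<forall>y\<in>states (wF n). \<exists>z\<in>states (k n).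
              F n y x = circ_mat G (wF n + k n) C (y @ z) (x @ z))))"

end

(*
A register of r - 1 lines can be rotated by one-qubit gates so that its number of leading ones (its
digit) is uniform on {0..r-1}. If every unit of the digit then contributes a phase alpha with
alpha^r = 1 and the rotation is undone, the amplitude at the zero state is the mean of
1, alpha, ..., alpha^(r-1). Hence afterwards the register is zero with certainty if alpha = 1 and
nonzero with certainty otherwise.

With r = q this copies a line c: rotate m registers, compute the sum of their digits modulo q by MOD_q
gates, apply the phase w_q^(c * sum), uncompute and rotate back. The phase is a product over the
registers, so each of them is now nonzero exactly when c = 1.

With r = p it computes MOD_p of m lines: the phase w_p^(digit * sum x_i) is a product of the phases
w_p^(u * x_i) over the thermometer bits u of the digit, and these can be applied in parallel to copies
of u. The register is now nonzero exactly when MOD_p(x) = 1; flip the target accordingly and undo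
everything.
*)

theory Submission
  imports Defs "HOL-Library.Nat_Bijection"
begin

text \<open>Copies are needed because the gates of one layer act on disjoint lines: a thermometer
  bit that must control one phase per input in constant depth has to be present once per input. A
  Fourier transform modulo \<open>r\<close> would be the natural tool, but \<open>r\<close> need not
  be a power of two; reading the digit as a number of leading ones needs only one layer of one-qubit
  rotations. The price is that merely zero against nonzero is controlled: a nonzero register is left
  in some entangled superposition that is never computed. Hence intermediate states are described by
  their supports only, and work lines are cleaned only by running the whole preparation backwards.
  Every gadget has the form \<open>B'\<close> after \<open>P\<close> after \<open>B\<close>, where
  \<open>P\<close> agrees, on the support that \<open>B\<close> produces, with an operator that
  commutes with \<open>B\<close>. A further obstacle is that a MOD gate answers only whether a count
  is divisible by \<open>q\<close>. The phase that depends on the residue is assembled from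
  \<open>q\<close> such answers, the count being shifted by \<open>j\<close> constant ones for each
  \<open>j < q\<close>.\<close>

section \<open>Gates acting on amplitude functions\<close>

text \<open>State vectors live on assignments of all lines \<open>0, 1, 2, \<dots>\<close>, so that operators need
  no width. Classical gates are involutions, hence act on vectors by pullback.\<close>

type_synonym vec = "(nat \<Rightarrow> bool) \<Rightarrow> complex"

fun clg :: "gate \<Rightarrow> (nat \<Rightarrow> bool) \<Rightarrow> nat \<Rightarrow> bool" where
  "clg (Toff cs t) y = y(t := (y t \<noteq> (\<forall>c\<in>set cs. y c)))"
| "clg (ModG q ys t) y = y(t := (y t \<noteq> Modq q (map y ys)))"
| "clg _ y = y"

fun app :: "gate \<Rightarrow> vec \<Rightarrow> vec" where
  "app (OneQ U i) \<psi> = (\<lambda>y. U (y i) False * \<psi> (y(i := False)) + U (y i) True * \<psi> (y(i := True)))"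
| "app g \<psi> = (\<lambda>y. \<psi> (clg g y))"

abbreviation run :: "gate list \<Rightarrow> vec \<Rightarrow> vec" where
  "run \<equiv> fold app"

text \<open>The only line that a gate can change. The value for oracles is a dummy; oracle gates are
  excluded through \<open>is_orc\<close> wherever \<open>wr\<close> matters.\<close>

fun wr :: "gate \<Rightarrow> nat" where
  "wr (OneQ U i) = i"
| "wr (Toff cs t) = t"
| "wr (ModG q ys t) = t"
| "wr (Orc m ls) = 0"

fun is_orc :: "gate \<Rightarrow> bool" where
  "is_orc (Orc m ls) = True"
| "is_orc _ = False"

definition mul :: "vec \<Rightarrow> vec \<Rightarrow> vec" where
  "mul d \<psi> = (\<lambda>y. d y * \<psi> y)"

text \<open>Phrased with single updates, so a change on several lines of \<open>W\<close> has to be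
  broken up into finitely many updates before it can be used.\<close>

definition indep :: "nat set \<Rightarrow> ((nat \<Rightarrow> bool) \<Rightarrow> 'a) \<Rightarrow> bool" where
  "indep W d \<longleftrightarrow> (\<forall>y i b. i \<in> W \<longrightarrow> d (y(i := b)) = d y)"

text \<open>Membership in the span of the basis states that satisfy \<open>P\<close>: the form a
  classical assertion takes for a state that may be entangled.\<close>

definition supp :: "((nat \<Rightarrow> bool) \<Rightarrow> bool) \<Rightarrow> vec \<Rightarrow> bool" where
  "supp P \<psi> \<longleftrightarrow> (\<forall>y. \<psi> y \<noteq> 0 \<longrightarrow> P y)"

lemma ball_fun_upd: "t \<notin> set cs \<Longrightarrow> (\<forall>c\<in>set cs. (y(t := b)) c) = (\<forall>c\<in>set cs. y c)"
  by auto

lemma map_fun_upd_notin: "t \<notin> set ys \<Longrightarrow> map (y(t := b)) ys = map y ys"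
  by auto

lemma clg_upd: "i \<notin> set (glines g) \<Longrightarrow> clg g (y(i := b)) = (clg g y)(i := b)"
  by (cases g) (simp_all add: ball_fun_upd map_fun_upd_notin fun_upd_twist del: fun_upd_apply map_fun_upd
        , simp_all add: fun_upd_twist)

lemma clg_other: "\<not> is_orc g \<Longrightarrow> i \<noteq> wr g \<Longrightarrow> clg g y i = y i"
  by (cases g) auto

lemma clg_as_upd: "\<not> is_orc g \<Longrightarrow> clg g y = y(wr g := clg g y (wr g))"
  by (cases g) (auto simp: fun_eq_iff)

lemma clg_commute:
  assumes "\<not> is_orc g" "\<not> is_orc h" "wr g \<notin> set (glines h)" "wr h \<notin> set (glines g)" "wr g \<noteq> wr h"
  shows "clg g (clg h y) = clg h (clg g y)"
proof -
  have "clg g (clg h y) = (clg g y)(wr h := clg h y (wr h))"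
    by (subst clg_as_upd[OF assms(2)]) (rule clg_upd[OF assms(4)])
  moreover have "clg h (clg g y) = (clg h y)(wr g := clg g y (wr g))"
    by (subst clg_as_upd[OF assms(1)]) (rule clg_upd[OF assms(3)])
  ultimately show ?thesis
    using assms(5) clg_other[OF assms(1)] clg_other[OF assms(2)] by (auto simp: fun_eq_iff)
qed

lemma wr_in: "\<not> is_orc g \<Longrightarrow> wr g \<in> set (glines g)"
  by (cases g) auto

lemma app_classical: "(\<And>U i. g \<noteq> OneQ U i) \<Longrightarrow> app g \<psi> = (\<lambda>y. \<psi> (clg g y))"
  by (cases g) auto

text \<open>Neither gate writes a line that the other reads or writes. Common control lines are
  allowed, so this is weaker than disjointness.\<close>

lemma app_commute:
  assumes "\<not> is_orc g" "\<not> is_orc h" "wr g \<notin> set (glines h)" "wr h \<notin> set (glines g)"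
  shows "app g (app h \<psi>) = app h (app g \<psi>)"
proof -
  have ne: "wr g \<noteq> wr h" using assms wr_in by metis
  consider (1) U i V j where "g = OneQ U i" "h = OneQ V j"
    | (2) U i where "g = OneQ U i" "\<And>V j. h \<noteq> OneQ V j"
    | (3) V j where "h = OneQ V j" "\<And>U i. g \<noteq> OneQ U i"
    | (4) "\<And>V j. h \<noteq> OneQ V j" "\<And>U i. g \<noteq> OneQ U i" by metis
  then show ?thesis
  proof cases
    case 1
    then have "i \<noteq> j" using ne by simp
    then show ?thesis using 1 by (auto simp: fun_eq_iff algebra_simps fun_upd_twist)
  next
    case 2
    then have i: "i \<notin> set (glines h)" "i \<noteq> wr h" using assms ne by auto
    show ?thesis unfolding app_classical[OF 2(2)] 2(1)
      using clg_upd[OF i(1)] clg_other[OF assms(2) i(2)] by simp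
  next
    case 3
    then have i: "j \<notin> set (glines g)" "j \<noteq> wr g" using assms ne by auto
    show ?thesis unfolding app_classical[OF 3(2)] 3(1)
      using clg_upd[OF i(1)] clg_other[OF assms(1) i(2)] by simp
  next
    case 4
    show ?thesis unfolding app_classical[OF 4(1)] app_classical[OF 4(2)]
      using clg_commute[OF assms ne] by simp
  qed
qed

lemma run_app_commute:
  assumes "\<And>g. g \<in> set gs \<Longrightarrow> \<not> is_orc g \<and> wr g \<notin> set (glines h) \<and> wr h \<notin> set (glines g)" "\<not> is_orc h"
  shows "run gs (app h \<psi>) = app h (run gs \<psi>)"
  using assms(1)
proof (induction gs arbitrary: \<psi>)
  case (Cons g gs)
  then show ?case using app_commute[of g h \<psi>] assms(2) by simp
qed simp

lemma run_commute:
  assumes "\<And>g h. g \<in> set gs \<Longrightarrow> h \<in> set hs \<Longrightarrow>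
      \<not> is_orc g \<and> \<not> is_orc h \<and> wr g \<notin> set (glines h) \<and> wr h \<notin> set (glines g)"
  shows "run gs (run hs \<psi>) = run hs (run gs \<psi>)"
  using assms
proof (induction hs arbitrary: \<psi>)
  case (Cons h hs)
  note prems = Cons.prems
  have "run gs (run (h # hs) \<psi>) = run hs (run gs (app h \<psi>))"
    using Cons.IH[of "app h \<psi>"] Cons.prems by (metis fold_simps(2) list.set_intros(2))
  also have "run gs (app h \<psi>) = app h (run gs \<psi>)"
  proof (cases gs)
    case (Cons g0 gs0)
    have "\<not> is_orc h" using prems[of g0 h] Cons by simp
    then show ?thesis by (rule run_app_commute[rotated]) (use prems in auto)
  qed simp
  finally show ?case by simp
qed simp

lemma app_mul:
  assumes "\<not> is_orc g" "indep {wr g} d"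
  shows "app g (mul d \<psi>) = mul d (app g \<psi>)"
proof (cases "\<exists>U i. g = OneQ U i")
  case True
  then show ?thesis using assms(2) by (auto simp: mul_def indep_def fun_eq_iff algebra_simps)
next
  case False
  then show ?thesis
    using assms(2) clg_as_upd[OF assms(1)] by (auto simp: app_classical mul_def indep_def) metis
qed

lemma indep_mono: "indep W d \<Longrightarrow> V \<subseteq> W \<Longrightarrow> indep V d"
  by (auto simp: indep_def)

lemma run_mul:
  assumes "indep W d" "\<And>g. g \<in> set gs \<Longrightarrow> \<not> is_orc g \<and> wr g \<in> W"
  shows "run gs (mul d \<psi>) = mul d (run gs \<psi>)"
  using assms(2)
proof (induction gs arbitrary: \<psi>)
  case (Cons g gs)
  have "indep {wr g} d" using Cons.prems assms(1) by (auto intro: indep_mono)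
  then show ?case using Cons app_mul[of g d \<psi>] by simp
qed simp

lemma supp_mul: "supp P \<psi> \<longleftrightarrow> mul (\<lambda>y. if P y then 1 else 0) \<psi> = \<psi>"
  by (auto simp: supp_def mul_def fun_eq_iff)

text \<open>Being supported in \<open>P\<close> means being fixed by the 0/1 diagonal of
  \<open>P\<close>, so this is an instance of gates commuting with a diagonal that they do not
  disturb.\<close>

lemma run_supp:
  assumes "supp P \<psi>" "indep W P" "\<And>g. g \<in> set gs \<Longrightarrow> \<not> is_orc g \<and> wr g \<in> W"
  shows "supp P (run gs \<psi>)"
proof -
  have "indep W (\<lambda>y. if P y then 1 else 0 :: complex)" using assms(2) by (auto simp: indep_def)
  from run_mul[OF this assms(3), of gs \<psi>] show ?thesis using assms(1) by (simp add: supp_mul)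
qed

lemma mul_mul: "mul d (mul e \<psi>) = mul (\<lambda>y. d y * e y) \<psi>"
  by (simp add: mul_def fun_eq_iff)

lemma mul_cong_supp: "supp P \<psi> \<Longrightarrow> (\<And>y. P y \<Longrightarrow> d y = e y) \<Longrightarrow> mul d \<psi> = mul e \<psi>"
  by (auto simp: mul_def supp_def fun_eq_iff)

lemma supp_mulI: "supp P \<psi> \<Longrightarrow> supp P (mul d \<psi>)"
  by (auto simp: mul_def supp_def)

lemma supp_weaken: "supp P \<psi> \<Longrightarrow> (\<And>y. P y \<Longrightarrow> Q y) \<Longrightarrow> supp Q \<psi>"
  by (auto simp: supp_def)

section \<open>Matrix entries as amplitudes\<close>

text \<open>Padding with \<open>False\<close> makes the width disappear: appending zero work bits to
  a basis state leaves its \<open>ext\<close> unchanged.\<close>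

definition ext :: "bool list \<Rightarrow> nat \<Rightarrow> bool" where
  "ext x i \<longleftrightarrow> i < length x \<and> x ! i"

definition pdisj :: "gate list \<Rightarrow> bool" where
  "pdisj gs \<longleftrightarrow> sorted_wrt (\<lambda>g h. set (glines g) \<inter> set (glines h) = {}) gs"

text \<open>The layer matrix without the layer constructor and the oracle family, so that induction
  over the gate list becomes possible.\<close>

definition LM :: "nat \<Rightarrow> gate list \<Rightarrow> qop" where
  "LM N gs y x = (\<Prod>g\<leftarrow>gs. gmat (\<lambda>_ _ _. 0) g (map ((!) y) (glines g)) (map ((!) x) (glines g))) *
      (if \<forall>i<N. (\<forall>g\<in>set gs. i \<notin> set (glines g)) \<longrightarrow> y!i = x!i then 1 else 0)"

lemma finite_states: "finite (states N)"
  unfolding states_def using finite_lists_length_eq[of "UNIV :: bool set" N] by simp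

lemma ext_upd: "length y = N \<Longrightarrow> t < N \<Longrightarrow> ext (y[t := b]) = (ext y)(t := b)"
  by (auto simp: ext_def fun_eq_iff nth_list_update)

lemma LM_single:
  assumes wf: "gate_wf (\<lambda>_. 0) N g" and no: "\<not> is_orc g" and y: "y \<in> states N"
  shows "(\<Sum>z\<in>states N. LM N [g] y z * \<psi> (ext z)) = app g \<psi> (ext y)"
proof -
  have ly: "length y = N" using y by (simp add: states_def)
  \<comment> \<open>Toffoli and MOD gates differ only in the predicate \<open>P\<close> of the
    control bits that triggers the flip, so both are treated at once.\<close>
  have perm: ?thesis
    if g: "glines g = cs @ [t]" "app g \<psi> = (\<lambda>y. \<psi> (clg g y))"
      and c: "clg g (ext y) = (ext y)(t := (y ! t \<noteq> P (map ((!) y) cs)))"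
      and m: "\<And>a b. gmat (\<lambda>_ _ _. 0) g a b = (if a = butlast b @ [last b \<noteq> P (butlast b)] then 1 else 0)"
    for cs t P
  proof -
    have t: "t < N" "t \<notin> set cs" "\<forall>i\<in>set cs. i < N" using wf g by (auto simp: gate_wf_def)
    \<comment> \<open>The only column with a nonzero entry in row \<open>y\<close>; the flip is its
      own inverse, so this preimage of \<open>y\<close> is also its image.\<close>
    define z0 where "z0 = y[t := (y ! t \<noteq> P (map ((!) y) cs))]"
    have z0s: "z0 \<in> states N" using ly by (simp add: z0_def states_def)
    have "LM N [g] y z = (if z = z0 then 1 else 0)" if z: "z \<in> states N" for z
    proof -
      have lz: "length z = N" using z by (simp add: states_def)
      have e: "(map ((!) y) cs @ [y ! t] = map ((!) z) cs @ [z ! t \<noteq> P (map ((!) z) cs)] \<and>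
         (\<forall>i<N. i \<notin> set (cs @ [t]) \<longrightarrow> y ! i = z ! i)) \<longleftrightarrow> z = z0" (is "?l \<longleftrightarrow> ?r")
      proof
        assume l: ?l
        then have mm: "map ((!) y) cs = map ((!) z) cs" and tt: "y ! t = (z ! t \<noteq> P (map ((!) z) cs))" by auto
        have "z ! i = z0 ! i" if i: "i < N" for i
        proof (cases "i = t")
          case True
          show ?thesis unfolding True z0_def mm using tt i ly True by (cases "P (map ((!) z) cs)") auto
        next
          case False
          then have "y ! i = z ! i" using l i mm by (cases "i \<in> set cs") auto
          then show ?thesis using False by (simp add: z0_def)
        qed
        then show ?r using lz ly by (intro nth_equalityI) (auto simp: z0_def)
      next
        assume r: ?r
        have mm: "map ((!) z) cs = map ((!) y) cs" using r t(2)
          by (intro map_cong refl) (metis z0_def nth_list_update_neq)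
        have "z ! t = (y ! t \<noteq> P (map ((!) y) cs))" using r t ly by (simp add: z0_def)
        then have "y ! t = (z ! t \<noteq> P (map ((!) z) cs))" unfolding mm by blast
        then show ?l using mm r by (auto simp: z0_def)
      qed
      have "LM N [g] y z = (if map ((!) y) cs @ [y ! t] = map ((!) z) cs @ [z ! t \<noteq> P (map ((!) z) cs)] \<and>
         (\<forall>i<N. i \<notin> set (cs @ [t]) \<longrightarrow> y ! i = z ! i) then 1 else 0)"
        unfolding LM_def by (simp add: m g(1) butlast_append) blast
      then show ?thesis unfolding e .
    qed
    then have "(\<Sum>z\<in>states N. LM N [g] y z * \<psi> (ext z)) = (\<Sum>z\<in>states N. if z = z0 then \<psi> (ext z0) else 0)"
      by (intro sum.cong) auto
    also have "\<dots> = \<psi> (ext z0)" using z0s finite_states by (simp add: sum.delta)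
    also have "ext z0 = clg g (ext y)" unfolding c z0_def using ext_upd[OF ly t(1)] by simp
    finally show ?thesis using g by simp
  qed
  have me: "map (ext y) cs = map ((!) y) cs" if "\<forall>i\<in>set cs. i < N" for cs
    using that ly by (auto simp: ext_def)
  show ?thesis
  proof (cases g)
    case (OneQ U i)
    then have i: "i < N" using wf by (auto simp: gate_wf_def)
    have "LM N [g] y z = (if z = y[i := False] then U (y ! i) False else 0) +
           (if z = y[i := True] then U (y ! i) True else 0)" if z: "z \<in> states N" for z
    proof -
      have lz: "length z = N" using z by (simp add: states_def)
      have ne: "y[i := False] \<noteq> y[i := True]" using i ly by (metis nth_list_update_eq)
      have e: "(\<forall>j<N. i \<noteq> j \<longrightarrow> y ! j = z ! j) \<longleftrightarrow> z = y[i := z ! i]"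
      proof
        assume a: "\<forall>j<N. i \<noteq> j \<longrightarrow> y ! j = z ! j"
        have "z ! j = y[i := z ! i] ! j" if "j < N" for j
          using a that ly by (cases "i = j") auto
        then show "z = y[i := z ! i]" using lz ly by (intro nth_equalityI) auto
      next
        assume a: "z = y[i := z ! i]"
        show "\<forall>j<N. i \<noteq> j \<longrightarrow> y ! j = z ! j" by (subst a) simp
      qed
      show ?thesis
      proof (cases "z = y[i := z ! i]")
        case True
        then show ?thesis using ne e by (cases "z ! i") (auto simp: LM_def OneQ)
      next
        case False
        then have "z \<noteq> y[i := False]" "z \<noteq> y[i := True]" using i ly by auto
        then show ?thesis using False e by (auto simp: LM_def OneQ)
      qed
    qed
    then have "(\<Sum>z\<in>states N. LM N [g] y z * \<psi> (ext z)) =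
      (\<Sum>z\<in>states N. (if z = y[i := False] then U (y ! i) False * \<psi> (ext (y[i := False])) else 0) +
           (if z = y[i := True] then U (y ! i) True * \<psi> (ext (y[i := True])) else 0))"
      by (intro sum.cong) (auto simp: algebra_simps)
    also have "\<dots> = U (y ! i) False * \<psi> (ext (y[i := False])) + U (y ! i) True * \<psi> (ext (y[i := True]))"
      using ly finite_states by (simp add: sum.distrib sum.delta states_def)
    finally show ?thesis using OneQ i ly by (simp add: ext_upd ext_def)
  next
    case (Toff cs t)
    then have l: "\<forall>i\<in>set cs. i < N" "t < N" using wf by (auto simp: gate_wf_def)
    show ?thesis
      by (rule perm[of cs t "\<lambda>b. \<forall>c\<in>set b. c"])
        (use l ly in \<open>auto simp: Toff ext_def fun_eq_iff perm_mat_def toff_fun_def\<close>)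
  next
    case (ModG q cs t)
    then have l: "\<forall>i\<in>set cs. i < N" "t < N" using wf by (auto simp: gate_wf_def)
    show ?thesis
      by (rule perm[of cs t "Modq q"])
        (use l ly in \<open>simp_all add: ModG perm_mat_def mod_fun_def me[OF l(1)] ext_def del: map_eq_conv\<close>)
  next
    case (Orc m ls)
    then show ?thesis using no by simp
  qed
qed

text \<open>Disjointness leaves a single intermediate state in the matrix product, so a Kronecker
  product can be peeled into successive gates.\<close>

lemma LM_Cons:
  assumes y: "y \<in> states N" and z: "z \<in> states N"
    and dj: "\<And>h. h \<in> set gs \<Longrightarrow> set (glines g) \<inter> set (glines h) = {}"
    and wf: "\<And>h. h \<in> set (g # gs) \<Longrightarrow> gate_wf (\<lambda>_. 0) N h"
  shows "LM N (g # gs) y z = (\<Sum>w\<in>states N. LM N gs y w * LM N [g] w z)"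
proof -
  \<comment> \<open>The lines of \<open>g\<close> are already final because no other gate touches
    them; all other lines are still as in \<open>z\<close> because \<open>g\<close> does not touch
    them.\<close>
  define w0 where "w0 = map (\<lambda>i. if i \<in> set (glines g) then y ! i else z ! i) [0..<N]"
  have w0n: "w0 ! i = (if i \<in> set (glines g) then y ! i else z ! i)" if "i < N" for i
    using that by (simp add: w0_def)
  have w0s: "w0 \<in> states N" by (simp add: w0_def states_def)
  have u: "LM N gs y w * LM N [g] w z = 0" if w: "w \<in> states N" "w \<noteq> w0" for w
  proof (rule ccontr)
    assume n: "LM N gs y w * LM N [g] w z \<noteq> 0"
    then have a: "\<And>i. i < N \<Longrightarrow> \<forall>g\<in>set gs. i \<notin> set (glines g) \<Longrightarrow> y ! i = w ! i"
      and b: "\<And>i. i < N \<Longrightarrow> i \<notin> set (glines g) \<Longrightarrow> w ! i = z ! i"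
      by (auto simp: LM_def split: if_splits)
    have "w = w0"
    proof (rule nth_equalityI)
      show "length w = length w0" using w by (simp add: w0_def states_def)
      fix i assume "i < length w"
      then have i: "i < N" using w by (simp add: states_def)
      show "w ! i = w0 ! i" using a[OF i] b[OF i] w0n[OF i] dj by auto
    qed
    then show False using w by simp
  qed
  have ln: "\<And>h i. h \<in> set (g # gs) \<Longrightarrow> i \<in> set (glines h) \<Longrightarrow> i < N" using wf by (auto simp: gate_wf_def)
  have m1: "map ((!) w0) (glines g) = map ((!) y) (glines g)"
  proof (rule map_cong[OF refl])
    fix i assume "i \<in> set (glines g)"
    then show "w0 ! i = y ! i" using w0n ln[of g i] by simp
  qed
  have m2: "map ((!) w0) (glines h) = map ((!) z) (glines h)" if "h \<in> set gs" for h
  proof (rule map_cong[OF refl])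
    fix i assume i: "i \<in> set (glines h)"
    then have "i \<notin> set (glines g)" using dj[OF that] by auto
    then show "w0 ! i = z ! i" using w0n ln[of h i] that i by auto
  qed
  have "(\<Sum>w\<in>states N. LM N gs y w * LM N [g] w z) = LM N gs y w0 * LM N [g] w0 z"
    by (subst sum.remove[OF finite_states w0s], subst sum.neutral) (use u in blast, simp)
  also have "\<dots> = LM N (g # gs) y z"
  proof -
    have p: "(\<Prod>h\<leftarrow>gs. gmat (\<lambda>_ _ _. 0) h (map ((!) y) (glines h)) (map ((!) w0) (glines h))) =
      (\<Prod>h\<leftarrow>gs. gmat (\<lambda>_ _ _. 0) h (map ((!) y) (glines h)) (map ((!) z) (glines h)))"
      by (intro arg_cong[where f = prod_list] map_cong refl) (use m2 in metis)
    have c1: "(\<forall>i<N. (\<forall>g\<in>set gs. i \<notin> set (glines g)) \<longrightarrow> y!i = w0!i) \<longleftrightarrow>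
       (\<forall>i<N. (\<forall>g\<in>set (g # gs). i \<notin> set (glines g)) \<longrightarrow> y!i = z!i)"
      using w0n by auto
    have c2: "\<forall>i<N. (\<forall>h\<in>set [g]. i \<notin> set (glines h)) \<longrightarrow> w0!i = z!i" using w0n by auto
    show ?thesis unfolding LM_def p c1 using c2 by (simp add: m1 del: map_eq_conv)
  qed
  finally show ?thesis by simp
qed

lemma LM_run:
  assumes "pdisj gs" "\<And>g. g \<in> set gs \<Longrightarrow> gate_wf (\<lambda>_. 0) N g \<and> \<not> is_orc g" "y \<in> states N"
  shows "(\<Sum>z\<in>states N. LM N gs y z * \<psi> (ext z)) = run gs \<psi> (ext y)"
  using assms
proof (induction gs arbitrary: \<psi>)
  case Nil
  have "LM N [] y z = (if z = y then 1 else 0)" if "z \<in> states N" for z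
    using that Nil by (auto simp: LM_def states_def list_eq_iff_nth_eq)
  then have "(\<Sum>z\<in>states N. LM N [] y z * \<psi> (ext z)) = (\<Sum>z\<in>states N. if z = y then \<psi> (ext y) else 0)"
    by (intro sum.cong) auto
  then show ?case using Nil finite_states by (simp add: sum.delta)
next
  case (Cons g gs)
  have pd: "pdisj gs" and dj: "\<And>h. h \<in> set gs \<Longrightarrow> set (glines g) \<inter> set (glines h) = {}"
    using Cons.prems by (auto simp: pdisj_def)
  have "run (g # gs) \<psi> (ext y) = (\<Sum>w\<in>states N. LM N gs y w * app g \<psi> (ext w))"
    using Cons.IH[OF pd _ Cons.prems(3), of "app g \<psi>"] Cons.prems by simp
  also have "\<dots> = (\<Sum>w\<in>states N. LM N gs y w * (\<Sum>z\<in>states N. LM N [g] w z * \<psi> (ext z)))"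
    by (intro sum.cong) (use LM_single Cons.prems in auto)
  also have "\<dots> = (\<Sum>z\<in>states N. (\<Sum>w\<in>states N. LM N gs y w * LM N [g] w z) * \<psi> (ext z))"
    unfolding sum_distrib_left sum_distrib_right by (subst sum.swap) (simp add: mult.assoc)
  also have "\<dots> = (\<Sum>z\<in>states N. LM N (g # gs) y z * \<psi> (ext z))"
    by (intro sum.cong) (use LM_Cons[OF Cons.prems(3)] dj Cons.prems in auto)
  finally show ?case by simp
qed

lemma layer_mat_LM:
  "(\<And>g. g \<in> set (layer_gates L) \<Longrightarrow> \<not> is_orc g) \<Longrightarrow> layer_mat G N L = LM N (layer_gates L)"
proof -
  assume a: "\<And>g. g \<in> set (layer_gates L) \<Longrightarrow> \<not> is_orc g"
  have "gmat G g = gmat (\<lambda>_ _ _. 0) g" if "\<not> is_orc g" for g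
    using that by (cases g) (auto simp: fun_eq_iff)
  then show ?thesis unfolding layer_mat_def LM_def Let_def using a
    by (intro ext arg_cong2[where f = "(*)"] arg_cong[where f = prod_list] map_cong) auto
qed

lemma layer_wf_pdisj:
  "layer_wf w N L \<longleftrightarrow> pdisj (layer_gates L) \<and> (\<forall>g\<in>set (layer_gates L). gate_wf w N g)"
proof -
  have "(\<forall>i<length gs. \<forall>j<length gs. i \<noteq> j \<longrightarrow> set (glines (gs!i)) \<inter> set (glines (gs!j)) = {}) \<longleftrightarrow>
     pdisj gs" (is "?l \<longleftrightarrow> _") for gs :: "gate list"
  proof
    assume ?l
    then show "pdisj gs" unfolding pdisj_def sorted_wrt_iff_nth_less
      using order_less_trans by blast
  next
    assume "pdisj gs"
    then have *: "set (glines (gs!i)) \<inter> set (glines (gs!j)) = {}" if "i < j" "j < length gs" for i j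
      using that unfolding pdisj_def sorted_wrt_iff_nth_less by blast
    show ?l
    proof (intro allI impI)
      fix i j assume "i < length gs" "j < length gs" "i \<noteq> j"
      then show "set (glines (gs!i)) \<inter> set (glines (gs!j)) = {}"
        using *[of i j] *[of j i] by (cases "i < j") (auto simp: Int_commute)
    qed
  qed
  then show ?thesis by (auto simp: layer_wf_def Let_def)
qed

lemma circ_mat_run:
  assumes "\<And>L. L \<in> set C \<Longrightarrow> layer_wf (\<lambda>_. 0) N L \<and> (\<forall>g\<in>set (layer_gates L). \<not> is_orc g)"
    and "y \<in> states N"
  shows "(\<Sum>z\<in>states N. circ_mat G N C y z * \<psi> (ext z)) = run (concat (map layer_gates C)) \<psi> (ext y)"
  using assms(1)
proof (induction C arbitrary: \<psi>)
  case Nil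
  have "(\<Sum>z\<in>states N. circ_mat G N [] y z * \<psi> (ext z)) = (\<Sum>z\<in>states N. if z = y then \<psi> (ext y) else 0)"
    by (intro sum.cong) (auto simp: op_id_def)
  then show ?case using assms(2) finite_states by (simp add: sum.delta)
next
  case (Cons L C)
  have "(\<Sum>z\<in>states N. circ_mat G N (L # C) y z * \<psi> (ext z)) =
     (\<Sum>w\<in>states N. circ_mat G N C y w * (\<Sum>z\<in>states N. layer_mat G N L w z * \<psi> (ext z)))"
    unfolding circ_mat.simps op_mult_def sum_distrib_left sum_distrib_right
    by (subst sum.swap) (simp add: mult.assoc)
  also have "\<dots> = (\<Sum>w\<in>states N. circ_mat G N C y w * run (layer_gates L) \<psi> (ext w))"
  proof (intro sum.cong refl arg_cong2[where f = "(*)"])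
    fix w assume w: "w \<in> states N"
    have "layer_wf (\<lambda>_. 0) N L" and o: "\<And>g. g \<in> set (layer_gates L) \<Longrightarrow> \<not> is_orc g"
      using Cons.prems[of L] by auto
    then show "(\<Sum>z\<in>states N. layer_mat G N L w z * \<psi> (ext z)) = run (layer_gates L) \<psi> (ext w)"
      using LM_run[of "layer_gates L" N w \<psi>] w by (simp add: layer_mat_LM[OF o] layer_wf_pdisj)
  qed
  also have "\<dots> = run (concat (map layer_gates (L # C))) \<psi> (ext y)"
    using Cons.IH[of "run (layer_gates L) \<psi>"] Cons.prems by (simp, metis)
  finally show ?case .
qed

lemma ext_inj: "x \<in> states N \<Longrightarrow> z \<in> states N \<Longrightarrow> ext z = ext x \<longleftrightarrow> z = x"
  by (auto simp: ext_def states_def fun_eq_iff list_eq_iff_nth_eq)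

text \<open>A matrix entry is the amplitude reached from the indicator of a basis state; from here
  on circuits are compared as operators \<open>run\<close> only.\<close>

lemma circ_mat_amplitude:
  assumes "\<And>L. L \<in> set C \<Longrightarrow> layer_wf (\<lambda>_. 0) N L \<and> (\<forall>g\<in>set (layer_gates L). \<not> is_orc g)"
    and "y \<in> states N" "x \<in> states N"
  shows "circ_mat G N C y x = run (concat (map layer_gates C)) (\<lambda>v. if v = ext x then 1 else 0) (ext y)"
proof -
  have "(\<Sum>z\<in>states N. circ_mat G N C y z * (if ext z = ext x then 1 else 0)) =
     (\<Sum>z\<in>states N. if z = x then circ_mat G N C y x else 0)"
    by (intro sum.cong) (use ext_inj[OF assms(3)] in auto)
  then show ?thesis using circ_mat_run[OF assms(1,2), where \<psi> = "\<lambda>v. if v = ext x then 1 else 0"]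
      assms(3) finite_states by (simp add: sum.delta)
qed

section \<open>Constant-depth circuits with MOD gates\<close>

definition gok :: "nat \<Rightarrow> mat2 set \<Rightarrow> gate \<Rightarrow> bool" where
  "gok q S g \<longleftrightarrow> distinct (glines g) \<and>
     (case g of OneQ U i \<Rightarrow> U \<in> S | Toff cs t \<Rightarrow> True | ModG r ys t \<Rightarrow> r = q | Orc m ls \<Rightarrow> False)"

definition gin :: "nat \<Rightarrow> mat2 set \<Rightarrow> nat set \<Rightarrow> nat set \<Rightarrow> gate \<Rightarrow> bool" where
  "gin q S L W g \<longleftrightarrow> gok q S g \<and> set (glines g) \<subseteq> L \<and> wr g \<in> W"

text \<open>\<open>L\<close> bounds the lines that are touched and \<open>W\<close> those that are
  written. Keeping \<open>W\<close> apart lets a diagonal that depends on lines that are only read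
  commute with the operator. The depth is exact, so that circuits can be merged layer by
  layer.\<close>

definition impl :: "nat \<Rightarrow> mat2 set \<Rightarrow> nat \<Rightarrow> nat set \<Rightarrow> nat set \<Rightarrow> (vec \<Rightarrow> vec) \<Rightarrow> bool" where
  "impl q S d L W A \<longleftrightarrow> (\<exists>C. length C = d \<and> A = run (concat C) \<and>
     (\<forall>gs\<in>set C. pdisj gs \<and> (\<forall>g\<in>set gs. gin q S L W g)))"

lemma gok_not_orc: "gok q S g \<Longrightarrow> \<not> is_orc g"
  by (cases g) (auto simp: gok_def)

lemma gin_mono: "gin q S L W g \<Longrightarrow> S \<subseteq> S' \<Longrightarrow> L \<subseteq> L' \<Longrightarrow> W \<subseteq> W' \<Longrightarrow> gin q S' L' W' g"
  by (auto simp: gin_def gok_def split: gate.splits)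

lemma impl_layer:
  assumes "pdisj gs" "\<And>g. g \<in> set gs \<Longrightarrow> gin q S L W g"
  shows "impl q S 1 L W (run gs)"
  unfolding impl_def using assms by (intro exI[of _ "[gs]"]) auto

lemma impl_id: "impl q S 0 L W (\<lambda>\<psi>. \<psi>)"
  unfolding impl_def by (intro exI[of _ "[]"]) auto

lemma impl_seq:
  assumes "impl q S d L W A" "impl q S e L W B"
  shows "impl q S (d + e) L W (\<lambda>\<psi>. B (A \<psi>))"
proof -
  obtain C where C: "length C = d" "A = run (concat C)"
     "\<forall>gs\<in>set C. pdisj gs \<and> (\<forall>g\<in>set gs. gin q S L W g)"
    using assms(1) unfolding impl_def by blast
  obtain D where D: "length D = e" "B = run (concat D)"
     "\<forall>gs\<in>set D. pdisj gs \<and> (\<forall>g\<in>set gs. gin q S L W g)"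
    using assms(2) unfolding impl_def by blast
  show ?thesis unfolding impl_def using C D by (intro exI[of _ "C @ D"]) auto
qed

lemma impl_mono:
  assumes "impl q S d L W A" "S \<subseteq> S'" "d \<le> d'" "L \<subseteq> L'" "W \<subseteq> W'"
  shows "impl q S' d' L' W' A"
proof -
  obtain C where C: "length C = d" "A = run (concat C)"
     "\<forall>gs\<in>set C. pdisj gs \<and> (\<forall>g\<in>set gs. gin q S L W g)"
    using assms(1) unfolding impl_def by blast
  have g: "gin q S L W g \<Longrightarrow> gin q S' L' W' g" for g using assms by (auto intro: gin_mono)
  \<comment> \<open>Empty layers pad the circuit to the larger depth.\<close>
  have "concat (C @ replicate (d' - d) []) = concat C" by simp
  then show ?thesis unfolding impl_def using C g assms(3)
    by (intro exI[of _ "C @ replicate (d' - d) []"]) (auto simp: pdisj_def)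
qed

lemma impl_subset: "impl q S d L W A \<Longrightarrow> L \<subseteq> L' \<Longrightarrow> W \<subseteq> W' \<Longrightarrow> impl q S d L' W' A"
  by (rule impl_mono) auto

lemma impl_fold:
  assumes "\<And>i. i \<in> set is \<Longrightarrow> impl q S d L W (A i)"
  shows "impl q S (length is * d) L W (fold A is)"
  using assms
proof (induction "is")
  case Nil
  then show ?case using impl_id[of q S L W] by (simp add: id_def)
next
  case (Cons i "is")
  have "impl q S (d + length is * d) L W (\<lambda>\<psi>. fold A is (A i \<psi>))"
    using Cons by (intro impl_seq) auto
  then show ?case by (simp add: comp_def)
qed

text \<open>Circuits on disjoint lines share their layers, so the depth does not add up.\<close>

lemma impl_par:
  assumes "impl q S d L1 W1 A" "impl q S d L2 W2 B" "L1 \<inter> L2 = {}"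
  shows "impl q S d (L1 \<union> L2) (W1 \<union> W2) (\<lambda>\<psi>. B (A \<psi>))"
proof -
  obtain C where C: "length C = d" "A = run (concat C)"
     "\<forall>gs\<in>set C. pdisj gs \<and> (\<forall>g\<in>set gs. gin q S L1 W1 g)"
    using assms(1) unfolding impl_def by blast
  obtain D where D: "length D = d" "B = run (concat D)"
     "\<forall>gs\<in>set D. pdisj gs \<and> (\<forall>g\<in>set gs. gin q S L2 W2 g)"
    using assms(2) unfolding impl_def by blast
  have r: "run (concat (map2 (@) C D)) \<psi> = run (concat D) (run (concat C) \<psi>)" for \<psi>
  proof -
    have "length C = length D" using C D by simp
    then show ?thesis using C(3) D(3)
    proof (induction C D arbitrary: \<psi> rule: list_induct2)
      case (Cons c C e D)
      \<comment> \<open>The first layer of the second circuit moves ahead of all remaining layers of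
        the first one.\<close>
      have "run (concat C) (run e (run c \<psi>)) = run e (run (concat C) (run c \<psi>))"
      proof (rule run_commute)
        fix g h assume "g \<in> set (concat C)" "h \<in> set e"
        then have g: "gok q S g" "set (glines g) \<subseteq> L1" and h: "gok q S h" "set (glines h) \<subseteq> L2"
          using Cons.prems by (auto simp: gin_def)
        then show "\<not> is_orc g \<and> \<not> is_orc h \<and> wr g \<notin> set (glines h) \<and> wr h \<notin> set (glines g)"
          using gok_not_orc wr_in assms(3) by blast
      qed
      then show ?case using Cons by simp
    qed simp
  qed
  have "\<forall>gs\<in>set (map2 (@) C D). pdisj gs \<and> (\<forall>g\<in>set gs. gin q S (L1 \<union> L2) (W1 \<union> W2) g)"
  proof
    fix gs assume "gs \<in> set (map2 (@) C D)"
    then obtain c e where ce: "c \<in> set C" "e \<in> set D" "gs = c @ e"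
      by (auto dest: set_zip_leftD set_zip_rightD)
    have "set (glines g) \<inter> set (glines h) = {}" if "g \<in> set c" "h \<in> set e" for g h
    proof -
      have "set (glines g) \<subseteq> L1" "set (glines h) \<subseteq> L2" using C(3) D(3) ce that by (auto simp: gin_def)
      then show ?thesis using assms(3) by blast
    qed
    then have "pdisj gs" using C(3) D(3) ce by (auto simp: pdisj_def sorted_wrt_append)
    then show "pdisj gs \<and> (\<forall>g\<in>set gs. gin q S (L1 \<union> L2) (W1 \<union> W2) g)"
      using C(3) D(3) ce gin_mono[of q S L1 W1 _ S "L1 \<union> L2" "W1 \<union> W2"]
        gin_mono[of q S L2 W2 _ S "L1 \<union> L2" "W1 \<union> W2"] by auto
  qed
  moreover have "(\<lambda>\<psi>. B (A \<psi>)) = run (concat (map2 (@) C D))" unfolding C(2) D(2) r[symmetric] ..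
  moreover have "length (map2 (@) C D) = d" using C D by simp
  ultimately show ?thesis unfolding impl_def by blast
qed

section \<open>Inverse circuits and conjugation\<close>

definition adj :: "mat2 \<Rightarrow> mat2" where
  "adj U i j = cnj (U j i)"

fun ginv :: "gate \<Rightarrow> gate" where
  "ginv (OneQ U i) = OneQ (adj U) i"
| "ginv g = g"

lemma ginv_simps [simp]: "glines (ginv g) = glines g" "wr (ginv g) = wr g"
  by (cases g; simp)+

lemma adj_adj [simp]: "adj (adj U) = U"
  by (simp add: adj_def fun_eq_iff)

text \<open>Closure under adjoints allows a circuit to be run backwards without leaving the fixed
  set of one-qubit gate types.\<close>

definition usys :: "mat2 set \<Rightarrow> bool" where
  "usys S \<longleftrightarrow> (\<forall>U\<in>S. unitary2 U \<and> adj U \<in> S)"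

lemma clg_clg: "distinct (glines g) \<Longrightarrow> clg g (clg g y) = y"
  by (cases g) (simp_all add: ball_fun_upd map_fun_upd_notin del: fun_upd_apply map_fun_upd
      , auto simp: fun_eq_iff)

lemma app_ginv:
  assumes "gok q S g" "usys S"
  shows "app (ginv g) (app g \<psi>) = \<psi>"
proof (cases g)
  case (OneQ U i)
  then have "unitary2 U" using assms by (auto simp: gok_def usys_def)
  then have u: "cnj (U False a) * U False b + cnj (U True a) * U True b = (if a = b then 1 else 0)" for a b
    by (auto simp: unitary2_def UNIV_bool)
  show ?thesis
  proof
    fix y :: "nat \<Rightarrow> bool"
    have y: "y(i := y i) = y" by simp
    have "app (ginv g) (app g \<psi>) y =
       (cnj (U False (y i)) * U False False + cnj (U True (y i)) * U True False) * \<psi> (y(i := False)) +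
       (cnj (U False (y i)) * U False True + cnj (U True (y i)) * U True True) * \<psi> (y(i := True))"
      by (simp add: OneQ adj_def algebra_simps)
    also have "\<dots> = \<psi> y" unfolding u using y by (cases "y i") auto
    finally show "app (ginv g) (app g \<psi>) y = \<psi> y" .
  qed
next
  case (Orc m ls)
  then show ?thesis by (simp add: fun_eq_iff)
qed (use assms clg_clg[of g] in \<open>auto simp: gok_def simp del: clg.simps glines.simps\<close>)

lemma gok_ginv: "gok q S g \<Longrightarrow> usys S \<Longrightarrow> gok q S (ginv g)"
  by (cases g) (auto simp: gok_def usys_def)

lemma gin_ginv: "gin q S L W g \<Longrightarrow> usys S \<Longrightarrow> gin q S L W (ginv g)"
  by (simp add: gin_def gok_ginv)

lemma run_inverse:
  assumes "\<And>g. g \<in> set gs \<Longrightarrow> gok q S g" "usys S"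
  shows "run (rev (map ginv gs)) (run gs \<psi>) = \<psi>"
  using assms(1)
proof (induction gs arbitrary: \<psi>)
  case (Cons g gs)
  then show ?case using app_ginv[OF _ assms(2), of q g \<psi>] by simp
qed simp

lemma impl_inverse:
  assumes "impl q S d L W A" "usys S"
  shows "\<exists>A'. impl q S d L W A' \<and> (\<forall>\<psi>. A' (A \<psi>) = \<psi>)"
proof -
  obtain C where C: "length C = d" "A = run (concat C)"
     "\<forall>gs\<in>set C. pdisj gs \<and> (\<forall>g\<in>set gs. gin q S L W g)"
    using assms(1) unfolding impl_def by blast
  define D where "D = rev (map (\<lambda>gs. rev (map ginv gs)) C)"
  have D: "concat D = rev (map ginv (concat C))"
    unfolding D_def by (induction C) auto
  have "pdisj (rev (map ginv gs)) = pdisj gs" for gs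
    unfolding pdisj_def by (simp add: sorted_wrt_rev sorted_wrt_map Int_commute)
  then have "impl q S d L W (run (concat D))" unfolding impl_def
    using C(1,3) gin_ginv assms(2) by (intro exI[of _ D]) (auto simp: D_def)
  moreover have "run (concat D) (A \<psi>) = \<psi>" for \<psi>
    unfolding D C(2) using C(3) assms(2) by (intro run_inverse) (auto simp: gin_def)
  ultimately show ?thesis by blast
qed

lemma impl_mul_commute:
  assumes "impl q S d L W A" "indep W f"
  shows "A (mul f \<psi>) = mul f (A \<psi>)"
proof -
  obtain C where C: "A = run (concat C)" "\<forall>gs\<in>set C. \<forall>g\<in>set gs. gin q S L W g"
    using assms(1) unfolding impl_def by blast
  have "\<not> is_orc g \<and> wr g \<in> W" if "g \<in> set (concat C)" for g
    using C(2) that gok_not_orc[of q S g] by (auto simp: gin_def)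
  then show ?thesis unfolding C(1) using run_mul[OF assms(2), of "concat C"] by blast
qed

text \<open>Lets a gate pass a circuit that reads the same inputs: the circuit must not write any
  line of \<open>h\<close>, and must not touch the target of \<open>h\<close>.\<close>

lemma impl_app_commute:
  assumes "impl q S d L W A" "W \<inter> set (glines h) = {}" "wr h \<notin> L" "\<not> is_orc h"
  shows "A (app h \<psi>) = app h (A \<psi>)"
proof -
  obtain C where C: "A = run (concat C)"
     "\<forall>gs\<in>set C. \<forall>g\<in>set gs. gin q S L W g"
    using assms(1) unfolding impl_def by blast
  show ?thesis unfolding C(1)
  proof (rule run_app_commute)
    fix g assume "g \<in> set (concat C)"
    then have "gok q S g \<and> set (glines g) \<subseteq> L \<and> wr g \<in> W" using C(2) by (auto simp: gin_def)
    then show "\<not> is_orc g \<and> wr g \<notin> set (glines h) \<and> wr h \<notin> set (glines g)"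
      using assms(2,3) gok_not_orc by auto
  qed (rule assms)
qed

text \<open>\<open>P\<close> has to act as the diagonal \<open>f\<close> on the single vector
  \<open>B \<psi>\<close> only, which is where knowledge of its support enters. As \<open>f\<close>
  ignores the lines that \<open>B\<close> writes, it can be taken out past \<open>B\<close>, and
  \<open>B'\<close> then cancels \<open>B\<close>.\<close>

lemma conjugate_diagonal:
  assumes "impl q S d L W B" "\<And>\<psi>. B' (B \<psi>) = \<psi>" "P (B \<psi>) = mul f (B \<psi>)" "indep W f"
  shows "B' (P (B \<psi>)) = mul f \<psi>"
  unfolding assms(3) using assms(2) impl_mul_commute[OF assms(1,4)] by metis

section \<open>Classical circuits\<close>

abbreviation cl :: "gate list \<Rightarrow> (nat \<Rightarrow> bool) \<Rightarrow> nat \<Rightarrow> bool" where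
  "cl \<equiv> fold clg"

definition classical :: "gate \<Rightarrow> bool" where
  "classical g \<longleftrightarrow> (\<forall>U i. g \<noteq> OneQ U i) \<and> distinct (glines g)"

lemma classical_simps [simp]:
  "classical (Toff cs t) \<longleftrightarrow> distinct cs \<and> t \<notin> set cs"
  "classical (ModG q cs t) \<longleftrightarrow> distinct cs \<and> t \<notin> set cs"
  by (auto simp: classical_def)

lemma run_classical:
  assumes "\<And>g. g \<in> set gs \<Longrightarrow> classical g"
  shows "run gs \<psi> = (\<lambda>y. \<psi> (cl (rev gs) y))"
  using assms
proof (induction gs arbitrary: \<psi>)
  case (Cons g gs)
  have "app g \<psi> = (\<lambda>y. \<psi> (clg g y))" using Cons.prems by (intro app_classical) (auto simp: classical_def)
  then show ?case using Cons by simp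
qed simp

lemma cl_rev:
  assumes "\<And>g. g \<in> set gs \<Longrightarrow> classical g"
  shows "cl (rev gs) (cl gs y) = y"
  using assms
  by (induction gs arbitrary: y) (auto simp: clg_clg classical_def)

text \<open>No target is a control and targets are distinct, so all conditions may be read off the
  initial assignment. Controls may be shared, hence a sequence of several layers can be evaluated as
  one block.\<close>

lemma cl_toffoli_block:
  assumes "distinct is" "\<And>i j. i \<in> set is \<Longrightarrow> j \<in> set is \<Longrightarrow> t i \<notin> set (cs j)" "inj_on t (set is)"
  shows "cl (map (\<lambda>i. Toff (cs i) (t i)) is) y =
    (\<lambda>v. y v \<noteq> (\<exists>i\<in>set is. v = t i \<and> (\<forall>c\<in>set (cs i). y c)))"
  using assms
proof (induction "is" arbitrary: y)
  case (Cons i "is")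
  define y' where "y' = clg (Toff (cs i) (t i)) y"
  have c: "(\<forall>c\<in>set (cs j). y' c) \<longleftrightarrow> (\<forall>c\<in>set (cs j). y c)" if "j \<in> set is" for j
    unfolding y'_def clg.simps using Cons.prems(2)[of i j] that by (intro ball_fun_upd) auto
  have n: "t j \<noteq> t i" if "j \<in> set is" for j using Cons.prems(1,3) that by (auto simp: inj_on_def)
  have "cl (map (\<lambda>i. Toff (cs i) (t i)) (i # is)) y = cl (map (\<lambda>i. Toff (cs i) (t i)) is) y'"
    by (simp add: y'_def)
  also have "\<dots> = (\<lambda>v. y' v \<noteq> (\<exists>i\<in>set is. v = t i \<and> (\<forall>c\<in>set (cs i). y' c)))"
    using Cons.prems by (intro Cons.IH) (auto simp: inj_on_def)
  also have "\<dots> = (\<lambda>v. y v \<noteq> (\<exists>j\<in>set (i # is). v = t j \<and> (\<forall>c\<in>set (cs j). y c)))"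
  proof
    fix v
    show "(y' v \<noteq> (\<exists>i\<in>set is. v = t i \<and> (\<forall>c\<in>set (cs i). y' c))) =
      (y v \<noteq> (\<exists>j\<in>set (i # is). v = t j \<and> (\<forall>c\<in>set (cs j). y c)))"
    proof (cases "v = t i")
      case True
      then have "\<not> (\<exists>j\<in>set is. v = t j \<and> Q j)" for Q using n by metis
      moreover have "y' v = (y v \<noteq> (\<forall>c\<in>set (cs i). y c))" using True by (simp add: y'_def)
      ultimately show ?thesis using True by auto
    next
      case False
      then have "y' v = y v" by (simp add: y'_def)
      then show ?thesis using False c by auto
    qed
  qed
  finally show ?case .
qed simp

section \<open>Digit registers\<close>

text \<open>A rotation in which \<open>n\<close> counts the lines that follow in the register. A
  zero stays zero with probability 1/(n+2), the share of digit 0 among the n+2 possible digits of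
  n+1 lines.\<close>

definition Vm :: "nat \<Rightarrow> mat2" where
  "Vm n out inp = complex_of_real (
     if out = inp then 1 / sqrt (n + 2) else if out then sqrt ((n + 1) / (n + 2)) else - sqrt ((n + 1) / (n + 2)))"

text \<open>Applied to the zero state of \<open>k\<close> lines, these rotations make the number of leading ones
  uniformly distributed on \<open>{0..k}\<close>.\<close>

fun Vg :: "nat list \<Rightarrow> gate list" where
  "Vg [] = []"
| "Vg (l # ls) = OneQ (Vm (length ls)) l # Vg ls"

definition lead :: "nat list \<Rightarrow> (nat \<Rightarrow> bool) \<Rightarrow> nat" where
  "lead ls y = length (takeWhile y ls)"

lemma Vm_sq: "(1 / sqrt (real n + 2))\<^sup>2 + (sqrt ((real n + 1) / (real n + 2)))\<^sup>2 = 1"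
  by (simp add: power_divide field_simps)

lemma unitary2_Vm: "unitary2 (Vm n)" "unitary2 (adj (Vm n))"
proof -
  define s where "s = 1 / sqrt (real n + 2)"
  define c where "c = sqrt ((real n + 1) / (real n + 2))"
  have V: "Vm n a b = complex_of_real (if a = b then s else if a then c else - c)" for a b
    by (simp add: Vm_def s_def c_def)
  have "complex_of_real s * complex_of_real s + complex_of_real c * complex_of_real c = 1"
    using Vm_sq[of n] unfolding s_def[symmetric] c_def[symmetric]
    by (metis of_real_1 of_real_add of_real_mult power2_eq_square)
  then show "unitary2 (Vm n)" "unitary2 (adj (Vm n))"
    by (auto simp: unitary2_def V UNIV_bool adj_def add.commute)
qed

text \<open>The expectation of \<open>d\<close> over the measured content of a rotated register, the
  other lines being kept as in \<open>y\<close>. The weights 1/(n+2) and (n+1)/(n+2) are the squared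
  entries of \<open>Vm n\<close>.\<close>

fun register_mean :: "nat list \<Rightarrow> vec \<Rightarrow> vec" where
  "register_mean [] d y = d y"
| "register_mean (l # ls) d y = (register_mean ls d (y(l := False)) +
     of_nat (length ls + 1) * register_mean ls d (y(l := True))) / of_nat (length ls + 2)"

lemma register_mean_cong:
  "(\<And>v. (\<And>i. i \<notin> set ls \<Longrightarrow> v i = y i) \<Longrightarrow> d v = e v) \<Longrightarrow> register_mean ls d y = register_mean ls e y"
proof (induction ls arbitrary: y)
  case (Cons l ls)
  have "register_mean ls d (y(l := b)) = register_mean ls e (y(l := b))" for b
    by (rule Cons.IH) (rule Cons.prems, auto)
  then show ?case by simp
qed simp

lemma register_mean_scale: "register_mean ls (\<lambda>v. c * d v) y = c * register_mean ls d y"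
  by (induction ls arbitrary: y) (auto simp: algebra_simps)

lemma register_mean_const: "register_mean ls (\<lambda>v. c) y = c"
proof (induction ls arbitrary: y)
  case (Cons l ls)
  have "(c + of_nat (length ls + 1) * c) / of_nat (length ls + 2) = c"
  proof -
    have "c + of_nat (length ls + 1) * c = of_nat (length ls + 2) * c" by (simp add: algebra_simps)
    moreover have "of_nat (length ls + 2) \<noteq> (0 :: complex)" by (simp only: of_nat_eq_0_iff)
    ultimately show ?thesis by simp
  qed
  then show ?case using Cons by simp
qed simp

text \<open>If the first line is zero the digit is 0; otherwise it is one more than the digit of the
  rest, which gives a factor \<open>a\<close>. The weights are such that the recursion produces the
  plain average of the powers.\<close>

lemma register_mean_lead:
  assumes "distinct ls"
  shows "register_mean ls (\<lambda>v. a ^ lead ls v) y = (\<Sum>k\<le>length ls. a ^ k) / of_nat (length ls + 1)"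
  using assms
proof (induction ls arbitrary: y)
  case Nil
  then show ?case by (simp add: lead_def)
next
  case (Cons l ls)
  have f: "register_mean ls (\<lambda>v. a ^ lead (l # ls) v) (y(l := False)) = 1"
    by (subst register_mean_cong[where e = "\<lambda>_. 1"]) (use Cons.prems in \<open>auto simp: lead_def register_mean_const\<close>)
  have t: "register_mean ls (\<lambda>v. a ^ lead (l # ls) v) (y(l := True)) =
     register_mean ls (\<lambda>v. a * a ^ lead ls v) (y(l := True))"
    by (rule register_mean_cong) (use Cons.prems in \<open>auto simp: lead_def\<close>)
  have n: "of_nat (length ls + 1) \<noteq> (0 :: complex)" by (simp only: of_nat_eq_0_iff)
  have "register_mean (l # ls) (\<lambda>v. a ^ lead (l # ls) v) y =
     (1 + a * (\<Sum>k\<le>length ls. a ^ k)) / of_nat (length ls + 2)"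
    unfolding register_mean.simps f t register_mean_scale using Cons n by (simp add: field_simps)
  also have "1 + a * (\<Sum>k\<le>length ls. a ^ k) = (\<Sum>k\<le>length (l # ls). a ^ k)"
    by (simp add: sum_distrib_left sum.atMost_Suc_shift del: sum.atMost_Suc)
  finally show ?case by simp
qed

lemma wr_Vg: "g \<in> set (Vg ls) \<Longrightarrow> \<not> is_orc g \<and> wr g \<in> set ls"
  by (induction ls) auto

lemma glines_Vg: "g \<in> set (Vg ls) \<Longrightarrow> glines g = [wr g]"
  by (induction ls) auto

lemma gok_Vg: "g \<in> set (Vg ls) \<Longrightarrow> (\<And>n. n < length ls \<Longrightarrow> Vm n \<in> S) \<Longrightarrow> gok q S g"
  by (induction ls) (auto simp: gok_def)

lemma indep_zero: "set ls \<inter> W = {} \<Longrightarrow> indep W (\<lambda>y. \<forall>l\<in>set ls. \<not> y l)"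
  by (auto simp: indep_def)

text \<open>Each line contributes its amplitude twice, once from the rotation and once from the
  adjoint, so the amplitudes turn into the probabilities used in
  \<open>register_mean\<close>.\<close>

lemma digit_amplitude:
  assumes "distinct ls" "supp (\<lambda>y. \<forall>l\<in>set ls. \<not> y l) \<psi>" "\<forall>l\<in>set ls. \<not> y l"
  shows "run (rev (map ginv (Vg ls))) (mul d (run (Vg ls) \<psi>)) y = register_mean ls d y * \<psi> y"
  using assms
proof (induction ls arbitrary: \<psi> y)
  case Nil
  then show ?case by (simp add: mul_def)
next
  case (Cons l ls)
  define s where "s = complex_of_real (1 / sqrt (real (length ls) + 2))"
  define c where "c = complex_of_real (sqrt ((real (length ls) + 1) / (real (length ls) + 2)))"
  have ss: "s * s = 1 / of_nat (length ls + 2)"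
    unfolding s_def of_real_mult[symmetric] by simp
  have cc: "c * c = of_nat (length ls + 1) / of_nat (length ls + 2)"
    unfolding c_def of_real_mult[symmetric] by (simp add: add.commute)
  let ?V = "OneQ (Vm (length ls)) l"
  \<comment> \<open>The first line is rotated first and rotated back last, so the induction
    hypothesis applies in between, once for each value of this line.\<close>
  define \<psi>' where "\<psi>' = app ?V \<psi>"
  have l: "l \<notin> set ls" "distinct ls" using Cons.prems by auto
  have "supp (\<lambda>y. \<forall>l\<in>set ls. \<not> y l) \<psi>" using Cons.prems(2) by (rule supp_weaken) auto
  then have "supp (\<lambda>y. \<forall>l\<in>set ls. \<not> y l) (run [?V] \<psi>)"
    by (rule run_supp[where W = "{l}"]) (use l in \<open>auto intro: indep_zero\<close>)
  then have sp: "supp (\<lambda>y. \<forall>l\<in>set ls. \<not> y l) \<psi>'" by (simp add: \<psi>'_def)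
  define X where "X = run (rev (map ginv (Vg ls))) (mul d (run (Vg ls) \<psi>'))"
  have X: "X (y(l := b)) = register_mean ls d (y(l := b)) * \<psi>' (y(l := b))" for b
    unfolding X_def by (rule Cons.IH[OF l(2) sp]) (use Cons.prems(3) l in auto)
  have yl: "y(l := False) = y" using Cons.prems(3) by (simp add: fun_upd_idem)
  have z: "\<psi> (y(l := True)) = 0"
  proof (rule ccontr)
    assume "\<psi> (y(l := True)) \<noteq> 0"
    then have "\<forall>i\<in>set (l # ls). \<not> (y(l := True)) i" using Cons.prems(2) unfolding supp_def by blast
    then show False by simp
  qed
  have p: "\<psi>' (y(l := b)) = (if b then c else s) * \<psi> y" for b
    using z yl by (simp add: \<psi>'_def Vm_def s_def c_def)
  have "run (rev (map ginv (Vg (l # ls)))) (mul d (run (Vg (l # ls)) \<psi>)) y = app (ginv ?V) X y"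
    by (simp add: X_def \<psi>'_def)
  also have "\<dots> = s * X (y(l := False)) + c * X (y(l := True))"
    using Cons.prems(3) by (simp add: adj_def Vm_def s_def c_def)
  also have "\<dots> = (s * s) * register_mean ls d (y(l := False)) * \<psi> y + (c * c) * register_mean ls d (y(l := True)) * \<psi> y"
    unfolding X p by simp
  also have "\<dots> = register_mean (l # ls) d y * \<psi> y"
    unfolding ss cc by (simp add: algebra_simps add_divide_distrib)
  finally show ?case .
qed

lemma run_Vg_inverse: "run (rev (map ginv (Vg ls))) (run (Vg ls) \<psi>) = \<psi>"
proof (rule run_inverse)
  let ?S = "{U. unitary2 U \<and> unitary2 (adj U)}"
  show "usys ?S" by (simp add: usys_def)
  show "gok 0 ?S g" if "g \<in> set (Vg ls)" for g using that by (rule gok_Vg) (simp add: unitary2_Vm)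
qed

text \<open>The phase \<open>\<alpha>\<close> may depend on all lines outside the register. Only the
  support of the result is recorded: for \<open>\<alpha> y \<noteq> 1\<close> the nonzero contents
  of the register stay unspecified.\<close>

lemma digit_test:
  assumes "distinct ls" "supp (\<lambda>y. \<forall>l\<in>set ls. \<not> y l) \<psi>" "indep (set ls) \<alpha>"
    and root: "\<And>y. \<alpha> y ^ (length ls + 1) = (1 :: complex)"
  shows "supp (\<lambda>y. (\<exists>l\<in>set ls. y l) \<longleftrightarrow> \<alpha> y \<noteq> 1)
    (run (rev (map ginv (Vg ls))) (mul (\<lambda>y. \<alpha> y ^ lead ls y) (run (Vg ls) \<psi>)))" (is "supp _ ?\<chi>")
  unfolding supp_def
proof (intro allI impI)
  fix y assume nz: "?\<chi> y \<noteq> 0"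
  show "(\<exists>l\<in>set ls. y l) \<longleftrightarrow> \<alpha> y \<noteq> 1"
  proof (cases "\<alpha> y = 1")
    case True
    \<comment> \<open>Where \<open>\<alpha>\<close> is 1 the phase disappears and the two rotations
      cancel; \<open>P\<close> cuts out this part of the state and commutes with the
      rotations.\<close>
    define P where "P = (\<lambda>y. if \<alpha> y = 1 then 1 else 0 :: complex)"
    have P: "indep (set ls) P" using assms(3) by (auto simp: P_def indep_def)
    have w: "\<And>g. g \<in> set (Vg ls) \<Longrightarrow> \<not> is_orc g \<and> wr g \<in> set ls"
      "\<And>g. g \<in> set (rev (map ginv (Vg ls))) \<Longrightarrow> \<not> is_orc g \<and> wr g \<in> set ls"
    proof -
      show "\<And>g. g \<in> set (Vg ls) \<Longrightarrow> \<not> is_orc g \<and> wr g \<in> set ls" by (rule wr_Vg)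
      have "is_orc (ginv g) = is_orc g" for g by (cases g) auto
      then show "\<And>g. g \<in> set (rev (map ginv (Vg ls))) \<Longrightarrow> \<not> is_orc g \<and> wr g \<in> set ls"
        using wr_Vg by auto
    qed
    have "mul P ?\<chi> = run (rev (map ginv (Vg ls))) (mul (\<lambda>y. P y * \<alpha> y ^ lead ls y) (run (Vg ls) \<psi>))"
      using run_mul[OF P w(2), of "rev (map ginv (Vg ls))" "mul (\<lambda>y. \<alpha> y ^ lead ls y) (run (Vg ls) \<psi>)"]
      by (simp add: mul_mul)
    also have "(\<lambda>y. P y * \<alpha> y ^ lead ls y) = P" by (auto simp: P_def fun_eq_iff)
    also have "run (rev (map ginv (Vg ls))) (mul P (run (Vg ls) \<psi>)) = mul P \<psi>"
      using run_mul[OF P w(1), of "Vg ls" \<psi>] run_Vg_inverse by metis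
    finally have "mul P ?\<chi> y = mul P \<psi> y" by (rule fun_cong)
    then have "\<psi> y = ?\<chi> y" by (simp add: mul_def P_def True)
    then have "\<psi> y \<noteq> 0" using nz by simp
    then show ?thesis using True assms(2) by (auto simp: supp_def)
  next
    case False
    have "?\<chi> y = 0" if z: "\<forall>l\<in>set ls. \<not> y l"
    proof -
      \<comment> \<open>\<open>indep\<close> covers single updates, so the register lines are
        changed one after the other.\<close>
      have al: "\<alpha> v = \<alpha> y" if e: "\<And>i. i \<notin> set ls \<Longrightarrow> v i = y i" for v
      proof -
        have "\<alpha> (override_on y v (set xs)) = \<alpha> y" if "set xs \<subseteq> set ls" for xs
          using that
        proof (induction xs)
          case (Cons x xs)
          have e: "override_on y v (set (x # xs)) = (override_on y v (set xs))(x := v x)"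
            by (simp add: override_on_def fun_eq_iff)
          have "\<alpha> (override_on y v (set (x # xs))) = \<alpha> ((override_on y v (set xs))(x := v x))"
            by (rule arg_cong[OF e])
          also have "\<dots> = \<alpha> (override_on y v (set xs))"
            using assms(3) Cons.prems unfolding indep_def by auto
          also have "\<dots> = \<alpha> y" using Cons by simp
          finally show ?case .
        qed (simp add: override_on_def)
        moreover have "override_on y v (set ls) = v" using e by (auto simp: override_on_def)
        ultimately show ?thesis by (metis order_refl)
      qed
      have "register_mean ls (\<lambda>y. \<alpha> y ^ lead ls y) y = register_mean ls (\<lambda>v. \<alpha> y ^ lead ls v) y"
      proof (rule register_mean_cong)
        fix v assume "\<And>i. i \<notin> set ls \<Longrightarrow> v i = y i"
        from al[OF this] show "\<alpha> v ^ lead ls v = \<alpha> y ^ lead ls v" by (rule arg_cong)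
      qed
      also have "\<dots> = (\<Sum>k\<le>length ls. \<alpha> y ^ k) / of_nat (length ls + 1)"
        by (rule register_mean_lead[OF assms(1)])
      \<comment> \<open>A full geometric sum over a root of unity different from 1.\<close>
      also have "(\<Sum>k\<le>length ls. \<alpha> y ^ k) = 0"
        using root[of y] False sum_gp_basic[of "\<alpha> y" "length ls"] by simp
      finally have "register_mean ls (\<lambda>y. \<alpha> y ^ lead ls y) y = 0" by simp
      then show ?thesis using digit_amplitude[OF assms(1,2) z] by simp
    qed
    then show ?thesis using nz False by auto
  qed
qed

section \<open>Phases\<close>

definition ph :: "complex \<Rightarrow> mat2" where
  "ph c a b = (if a = b then if a then c else 1 else 0)"

definition rt :: "nat \<Rightarrow> complex" where
  "rt n = cis (2 * pi / real n)"

lemma app_ph: "app (OneQ (ph c) i) = mul (\<lambda>y. if y i then c else 1)"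
proof (intro ext)
  fix \<psi> and y :: "nat \<Rightarrow> bool"
  have "y(i := y i) = y" by simp
  then show "app (OneQ (ph c) i) \<psi> y = mul (\<lambda>y. if y i then c else 1) \<psi> y"
    by (cases "y i") (auto simp: ph_def mul_def)
qed

lemma unitary2_ph: "cmod c = 1 \<Longrightarrow> unitary2 (ph c) \<and> unitary2 (adj (ph c))"
proof -
  assume "cmod c = 1"
  then have "c * cnj c = 1" "cnj c * c = 1"
    using complex_norm_square[of c] by (simp_all add: mult.commute)
  then show ?thesis by (auto simp: unitary2_def UNIV_bool adj_def ph_def)
qed

lemma rt_power_eq_1: "n > 0 \<Longrightarrow> rt n ^ k = 1 \<longleftrightarrow> n dvd k"
proof -
  assume n: "n > 0"
  have "rt n ^ k = cis (real k * (2 * pi / real n))" by (simp add: rt_def DeMoivre)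
  also have "\<dots> = 1 \<longleftrightarrow> (\<exists>j::int. real k * (2 * pi / real n) = 2 * pi * j)"
  proof -
    have "cis x = 1 \<longleftrightarrow> cos x = 1" for x
    proof
      assume "cos x = 1"
      then have "sin x = 0" using sin_cos_squared_add[of x] by simp
      then show "cis x = 1" using \<open>cos x = 1\<close> by (simp add: complex_eq_iff)
    qed (simp add: complex_eq_iff)
    then show ?thesis unfolding cos_one_2pi_int by (auto simp: mult_ac)
  qed
  also have "\<dots> \<longleftrightarrow> (\<exists>j::int. int k = int n * j)"
  proof -
    have "real k * (2 * pi / real n) = 2 * pi * j \<longleftrightarrow> int k = int n * j" for j :: int
    proof -
      have "real k * (2 * pi / real n) = 2 * pi * j \<longleftrightarrow> real k = real n * j"
        using n by (auto simp: field_simps)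
      also have "\<dots> \<longleftrightarrow> real_of_int (int k) = real_of_int (int n * j)" by simp
      also have "\<dots> \<longleftrightarrow> int k = int n * j" by (simp only: of_int_eq_iff)
      finally show ?thesis .
    qed
    then show ?thesis by simp
  qed
  also have "\<dots> \<longleftrightarrow> n dvd k" by (metis dvd_def int_dvd_int_iff)
  finally show ?thesis .
qed

lemma fold_mul: "fold (\<lambda>j. mul (f j)) js \<psi> = mul (\<lambda>y. \<Prod>j\<leftarrow>js. f j y) \<psi>"
  by (induction js arbitrary: \<psi>) (auto simp: mul_def fun_eq_iff mult_ac)

text \<open>Exactly one \<open>j < q\<close> makes \<open>s + j\<close> divisible by
  \<open>q\<close>, namely the residue of -s, and for it \<open>rt q ^ (q - j)\<close> equals
  \<open>rt q ^ s\<close>. Divisibility tests alone therefore produce the phase.\<close>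

lemma prod_residue_phase:
  assumes "q \<ge> 1"
  shows "(\<Prod>j<q. if c \<and> q dvd s + j then rt q ^ (q - j) else 1) = (if c then rt q ^ s else 1)"
proof (cases c)
  case True
  define j0 where "j0 = (q - s mod q) mod q"
  have j0: "j0 < q" using assms by (simp add: j0_def)
  have d0: "q dvd s + j0"
  proof (cases "s mod q = 0")
    case False
    have "s mod q < q" using assms by simp
    then have "j0 = q - s mod q" using False by (simp add: j0_def)
    moreover have "s + (q - s mod q) = q * (s div q) + q"
      using \<open>s mod q < q\<close> mult_div_mod_eq[of q s] by linarith
    ultimately show ?thesis by simp
  qed (auto simp: j0_def)
  have u: "j = j0" if "j < q" "q dvd s + j" for j
  proof -
    have "q dvd (s + j) - (s + j0)" "q dvd (s + j0) - (s + j)"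
      using that d0 by (blast intro: dvd_diff_nat)+
    then have "q dvd j - j0" "q dvd j0 - j" by simp_all
    moreover have "j - j0 < q" "j0 - j < q" using that j0 by simp_all
    ultimately have "j - j0 = 0" "j0 - j = 0" using nat_dvd_not_less by blast+
    then show ?thesis by simp
  qed
  have "(\<Prod>j<q. if c \<and> q dvd s + j then rt q ^ (q - j) else 1) = (\<Prod>j<q. if j = j0 then rt q ^ (q - j0) else 1)"
  proof (rule prod.cong[OF refl])
    fix j assume "j \<in> {..<q}"
    then have "c \<and> q dvd s + j \<longleftrightarrow> j = j0" using u d0 True by blast
    then show "(if c \<and> q dvd s + j then rt q ^ (q - j) else 1) = (if j = j0 then rt q ^ (q - j0) else 1)"
      by simp
  qed
  also have "\<dots> = rt q ^ (q - j0)" using j0 by (simp add: prod.delta)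
  also have "\<dots> = rt q ^ s"
  proof -
    have "rt q ^ (s + j0) = 1" "rt q ^ (q - j0 + j0) = 1" using d0 j0 assms by (auto simp: rt_power_eq_1)
    moreover have "rt q ^ j0 \<noteq> 0" by (simp add: rt_def)
    moreover have "rt q ^ (q - j0) * rt q ^ j0 = rt q ^ s * rt q ^ j0"
      using calculation(1,2) by (simp only: power_add)
    ultimately show ?thesis using mult_right_cancel by blast
  qed
  finally show ?thesis using True by simp
qed simp

lemma prod_power_count:
  "(\<Prod>i<length xs. if y (xs ! i) then a else 1) = a ^ length (filter id (map y xs))" for a :: complex
proof (induction xs)
  case (Cons x xs)
  have "(\<Prod>i<length (x # xs). if y ((x # xs) ! i) then a else 1) =
      (if y x then a else 1) * (\<Prod>i<length xs. if y (xs ! i) then a else 1)"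
    by (simp add: prod.lessThan_Suc_shift del: prod.lessThan_Suc)
  then show ?case using Cons by simp
qed simp

text \<open>Links the thermometer code of a digit with the digit: the prefix condition holds exactly
  at the positions before the first failure.\<close>

lemma filter_prefix: "length (filter (\<lambda>l. \<forall>j\<le>l. Q j) [0..<K]) = length (takeWhile Q [0..<K])"
proof (induction K)
  case (Suc K)
  show ?case
  proof (cases "\<forall>j<K. Q j")
    case True
    then have "takeWhile Q [0..<K] = [0..<K]" "filter (\<lambda>l. \<forall>j\<le>l. Q j) [0..<K] = [0..<K]"
      by (auto simp: takeWhile_eq_all_conv filter_id_conv)
    moreover have "(\<forall>j\<le>K. Q j) \<longleftrightarrow> Q K" using True by (metis le_neq_implies_less order_refl)
    ultimately show ?thesis using True by (simp add: takeWhile_append)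
  next
    case False
    then obtain j where "j < K" "\<not> Q j" by auto
    then have "takeWhile Q ([0..<K] @ [K]) = takeWhile Q [0..<K]" "\<not> (\<forall>j\<le>K. Q j)"
      using takeWhile_append1[of j "[0..<K]" Q "[K]"]
      by (auto intro: exI[of _ j])
    then show ?thesis using Suc by simp
  qed
qed simp

lemma lead_map_upt: "lead (map f [0..<K]) y = length (filter (\<lambda>l. \<forall>j\<le>l. y (f j)) [0..<K])"
  unfolding filter_prefix by (simp add: lead_def takeWhile_map comp_def)

lemma pdisj_map:
  assumes "distinct is"
    "\<And>i j. i \<in> set is \<Longrightarrow> j \<in> set is \<Longrightarrow> i \<noteq> j \<Longrightarrow> set (glines (g i)) \<inter> set (glines (g j)) = {}"
  shows "pdisj (map g is)"
  using assms unfolding pdisj_def sorted_wrt_map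
  by (induction "is") auto

lemma impl_layers:
  assumes "\<And>gs. gs \<in> set C \<Longrightarrow> pdisj gs \<and> (\<forall>g\<in>set gs. gin q S L W g)"
  shows "impl q S (length C) L W (run (concat C))"
  unfolding impl_def using assms by blast

lemma run_rev_mul:
  assumes "\<And>g. g \<in> set K \<Longrightarrow> classical g"
  shows "run (rev K) (mul f (run K \<psi>)) = mul (\<lambda>y. f (cl K y)) \<psi>"
proof -
  have "run (rev K) (mul f (run K \<psi>)) = (\<lambda>y. f (cl K y) * \<psi> (cl (rev K) (cl K y)))"
    using assms by (subst (1 2) run_classical) (auto simp: mul_def)
  then show ?thesis using cl_rev[OF assms] by (simp add: mul_def)
qed

text \<open>Compute, apply a phase, uncompute. The result is diagonal for every content of the work
  lines, because the classical circuit is undone exactly; clean work lines matter only when the new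
  diagonal is evaluated.\<close>

lemma impl_conjugate:
  assumes "\<And>gs. gs \<in> set C \<Longrightarrow> pdisj gs \<and> (\<forall>g\<in>set gs. gin q S L W g \<and> classical g)"
    and "impl q S d L W (mul f)"
  shows "impl q S (2 * length C + d) L W (mul (\<lambda>y. f (cl (concat C) y)))"
proof -
  have 1: "impl q S (length C) L W (run (concat C))" using assms(1) by (intro impl_layers) auto
  have "pdisj (rev gs) = pdisj gs" for gs unfolding pdisj_def by (simp add: sorted_wrt_rev Int_commute)
  then have "impl q S (length (rev (map rev C))) L W (run (concat (rev (map rev C))))"
    using assms(1) by (intro impl_layers) auto
  then have 2: "impl q S (length C) L W (run (rev (concat C)))" by (simp add: rev_concat rev_map)
  have e: "(\<lambda>\<psi>. run (rev (concat C)) (mul f (run (concat C) \<psi>))) = mul (\<lambda>y. f (cl (concat C) y))"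
    using assms(1) by (intro ext run_rev_mul) auto
  have "length C + d + length C = 2 * length C + d" by simp
  then show ?thesis using impl_seq[OF impl_seq[OF 1 assms(2)] 2] unfolding e by (simp only:)
qed

section \<open>Copying a line with MOD gates\<close>

text \<open>\<open>p\<close> is the modulus to be simulated and \<open>q\<close> the one available.
  The set \<open>S\<close> depends on the two moduli only, so the number of gate types is
  independent of the circuit width.\<close>

locale mod_gates =
  fixes p q :: nat and S :: "mat2 set"
  assumes p_ge: "p \<ge> 2" and q_ge: "q \<ge> 2" and usys: "usys S"
    and Vm_S: "\<And>n. n < p + q \<Longrightarrow> Vm n \<in> S"
    and ph_q: "\<And>j. j \<le> q \<Longrightarrow> ph (rt q ^ j) \<in> S" and ph_p: "ph (rt p) \<in> S"

text \<open>Roles of the work lines \<open>ln k i j\<close>: \<open>k = 0, 1\<close> are line \<open>j\<close> of the \<open>q\<close>-digit register \<open>i\<close> and of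
  its thermometer code, \<open>k = 2\<close> the copies, \<open>k = 3\<close> their conjunctions with the inputs, \<open>k = 4\<close> the
  test for a residue of the digit sum, \<open>k = 5\<close> that test controlled by the copied line, \<open>k = 6\<close>
  constant ones, and \<open>k = 7, 8\<close> the \<open>p\<close>-digit register and its thermometer code.\<close>

locale ancillas = mod_gates +
  fixes ln :: "nat \<Rightarrow> nat \<Rightarrow> nat \<Rightarrow> nat" and xs :: "nat list"
  assumes ln_inj [simp]: "\<And>k i j k' i' j'. ln k i j = ln k' i' j' \<longleftrightarrow> k = k' \<and> i = i' \<and> j = j'"
    and xs: "distinct xs" and ln_xs [simp]: "\<And>k i j. ln k i j \<notin> set xs"
begin

text \<open>\<open>blk 7\<close> serves the copying of one line and \<open>blk 9\<close> the whole
  gadget. The bound on \<open>i\<close> is not strict, so that index 0 exists even for an empty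
  input list.\<close>

definition blk :: "nat \<Rightarrow> nat set" where
  "blk n = {ln k i j |k i j. k < n \<and> i \<le> length xs \<and> j < p + q}"

lemma in_blk [simp]: "ln k i j \<in> blk n \<longleftrightarrow> k < n \<and> i \<le> length xs \<and> j < p + q"
  by (auto simp: blk_def)

text \<open>Layer \<open>l\<close> computes thermometer bit \<open>l\<close> of all registers at
  once. Different bits of one register share controls and need separate layers, but their number
  \<open>K\<close> is constant.\<close>

definition thermL :: "nat \<Rightarrow> nat \<Rightarrow> nat \<Rightarrow> nat \<Rightarrow> gate list list" where
  "thermL k k' I K = map (\<lambda>l. map (\<lambda>i. Toff (map (ln k i) [0..<Suc l]) (ln k' i l)) [0..<I]) [0..<K]"

lemma bex_product:
  "(\<exists>z\<in>set (List.product [0..<K] [0..<I]). v = f (fst z) (snd z) \<and> Q (fst z) (snd z)) \<longleftrightarrow>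
    (\<exists>l<K. \<exists>i<I. v = f l i \<and> Q l i)"
  unfolding Bex_def set_product set_upt split_paired_Ex by auto

lemma cl_therm:
  assumes "k \<noteq> k'"
  shows "cl (concat (thermL k k' I K)) y =
    (\<lambda>v. y v \<noteq> (\<exists>l<K. \<exists>i<I. v = ln k' i l \<and> (\<forall>j\<le>l. y (ln k i j))))"
proof -
  let ?pr = "List.product [0..<K] [0..<I]"
  have e: "concat (thermL k k' I K) =
    map (\<lambda>z. Toff (map (ln k (snd z)) [0..<Suc (fst z)]) (ln k' (snd z) (fst z))) ?pr"
    by (simp add: thermL_def product_concat_map map_concat comp_def)
  have c: "cl (map (\<lambda>z. Toff (map (ln k (snd z)) [0..<Suc (fst z)]) (ln k' (snd z) (fst z))) ?pr) y =
    (\<lambda>v. y v \<noteq> (\<exists>z\<in>set ?pr. v = ln k' (snd z) (fst z) \<and>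
     (\<forall>c\<in>set (map (ln k (snd z)) [0..<Suc (fst z)]). y c)))"
    by (rule cl_toffoli_block) (use assms in \<open>auto simp: distinct_product inj_on_def\<close>)
  have a: "(\<forall>c\<in>set (map (ln k i) [0..<Suc l]). y c) \<longleftrightarrow> (\<forall>j\<le>l. y (ln k i j))" for i l
    unfolding set_map set_upt by (auto simp: less_Suc_eq_le)
  have b: "(\<exists>z\<in>set ?pr. v = ln k' (snd z) (fst z) \<and> (\<forall>j\<le>fst z. y (ln k (snd z) j))) \<longleftrightarrow>
      (\<exists>l<K. \<exists>i<I. v = ln k' i l \<and> (\<forall>j\<le>l. y (ln k i j)))" for v
    by (rule bex_product)
  show ?thesis unfolding e c a b by (rule refl)
qed

lemma therm_layer:
  assumes "gs \<in> set (thermL k k' I K)" "k \<noteq> k'"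
    "\<And>i j. i < I \<Longrightarrow> j < K \<Longrightarrow> ln k i j \<in> L \<and> ln k' i j \<in> L \<and> ln k' i j \<in> W"
  shows "pdisj gs \<and> (\<forall>g\<in>set gs. gin q S L W g \<and> classical g)"
proof -
  obtain l where l: "l < K" "gs = map (\<lambda>i. Toff (map (ln k i) [0..<Suc l]) (ln k' i l)) [0..<I]"
    using assms(1) by (auto simp: thermL_def)
  have "pdisj gs" unfolding l using assms(2) by (intro pdisj_map) auto
  moreover have "gin q S L W g \<and> classical g" if g: "g \<in> set gs" for g
  proof -
    obtain i where i: "i < I" "g = Toff (map (ln k i) [0..<Suc l]) (ln k' i l)"
      using g unfolding l(2) set_map set_upt by fastforce
    then show ?thesis using assms(2,3) l(1) by (auto simp: gin_def gok_def distinct_map inj_on_def)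
  qed
  ultimately show ?thesis by blast
qed

text \<open>De Morgan: negate the register, take the conjunction, restore the register, negate the
  target.\<close>

definition orL :: "nat \<Rightarrow> nat \<Rightarrow> nat \<Rightarrow> (nat \<Rightarrow> nat) \<Rightarrow> gate list list" where
  "orL k K I tt = (let X = map (\<lambda>z. Toff [] (ln k (fst z) (snd z))) (List.product [0..<I] [0..<K]) in
     [X, map (\<lambda>i. Toff (map (ln k i) [0..<K]) (tt i)) [0..<I], X, map (\<lambda>i. Toff [] (tt i)) [0..<I]])"

lemma run_or:
  assumes "inj_on tt {..<I}" "\<And>i i' j. i < I \<Longrightarrow> tt i \<noteq> ln k i' j"
  shows "run (concat (orL k K I tt)) \<psi> = (\<lambda>y. \<psi> (\<lambda>v. y v \<noteq> (\<exists>i<I. v = tt i \<and> (\<exists>j<K. y (ln k i j)))))"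
proof -
  let ?pr = "rev (List.product [0..<I] [0..<K])"
  let ?X = "map (\<lambda>z. Toff [] (ln k (fst z) (snd z))) ?pr"
  let ?T = "map (\<lambda>i. Toff (map (ln k i) [0..<K]) (tt i)) (rev [0..<I])"
  let ?N = "map (\<lambda>i. Toff [] (tt i)) (rev [0..<I])"
  \<comment> \<open>Amplitudes are pulled back, so the blocks act on assignments in reverse order,
    the negation of the targets coming first.\<close>
  have rv: "rev (concat (orL k K I tt)) = ?N @ ?X @ ?T @ ?X"
    by (simp add: orL_def Let_def rev_map)
  have b: "(\<exists>i\<in>set (rev [0..<I]). Q i) \<longleftrightarrow> (\<exists>i<I. Q i)" for Q by auto
  have c: "(\<forall>c\<in>set (map (ln k i) [0..<K]). y c) \<longleftrightarrow> (\<forall>j<K. y (ln k i j))" for y i by auto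
  have N: "cl ?N y = (\<lambda>v. y v \<noteq> (\<exists>i<I. v = tt i))" for y
  proof -
    have "cl ?N y = (\<lambda>v. y v \<noteq> (\<exists>i\<in>set (rev [0..<I]). v = tt i \<and> (\<forall>c\<in>set []. y c)))"
      by (rule cl_toffoli_block) (use assms in \<open>auto simp: inj_on_def\<close>)
    then show ?thesis unfolding b by simp
  qed
  have X: "cl ?X y = (\<lambda>v. y v \<noteq> (\<exists>i<I. \<exists>j<K. v = ln k i j))" for y
  proof -
    have "cl ?X y = (\<lambda>v. y v \<noteq> (\<exists>z\<in>set ?pr. v = ln k (fst z) (snd z) \<and> (\<forall>c\<in>set []. y c)))"
      by (rule cl_toffoli_block) (auto simp: inj_on_def distinct_product)
    moreover have "(\<exists>z\<in>set ?pr. v = ln k (fst z) (snd z) \<and> (\<forall>c\<in>set []. y c)) \<longleftrightarrow> (\<exists>i<I. \<exists>j<K. v = ln k i j)" for v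
      unfolding set_rev bex_product[of I K v "ln k" "\<lambda>l i. \<forall>c\<in>set []. y c"] by simp
    ultimately show ?thesis by (simp only:)
  qed
  have T: "cl ?T y = (\<lambda>v. y v \<noteq> (\<exists>i<I. v = tt i \<and> (\<forall>j<K. y (ln k i j))))" for y
  proof -
    have "cl ?T y = (\<lambda>v. y v \<noteq> (\<exists>i\<in>set (rev [0..<I]). v = tt i \<and> (\<forall>c\<in>set (map (ln k i) [0..<K]). y c)))"
      by (rule cl_toffoli_block) (use assms in \<open>auto simp: inj_on_def\<close>)
    then show ?thesis unfolding b c .
  qed
  have "cl (rev (concat (orL k K I tt))) y = (\<lambda>v. y v \<noteq> (\<exists>i<I. v = tt i \<and> (\<exists>j<K. y (ln k i j))))" for y
  proof
    fix v
    define y1 where "y1 = (\<lambda>v. y v \<noteq> (\<exists>i<I. v = tt i))"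
    define y2 where "y2 = (\<lambda>v. y1 v \<noteq> (\<exists>i<I. \<exists>j<K. v = ln k i j))"
    define y3 where "y3 = (\<lambda>v. y2 v \<noteq> (\<exists>i<I. v = tt i \<and> (\<forall>j<K. y2 (ln k i j))))"
    have cl: "cl (rev (concat (orL k K I tt))) y = (\<lambda>v. y3 v \<noteq> (\<exists>i<I. \<exists>j<K. v = ln k i j))"
    proof -
      have "cl ?N y = y1" "cl ?X y1 = y2" "cl ?T y2 = y3"
        unfolding N X T y1_def y2_def y3_def by (rule refl)+
      then show ?thesis unfolding rv fold_append comp_apply by (simp only: X)
    qed
    have y1l: "y1 (ln k i j) = y (ln k i j)" for i j
    proof -
      have "\<not> (\<exists>i'<I. ln k i j = tt i')" using assms(2) by metis
      then show ?thesis by (simp add: y1_def)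
    qed
    have y2l: "y2 (ln k i j) = (\<not> y (ln k i j))" if "i < I" "j < K" for i j
      using that by (auto simp: y2_def y1l)
    show "cl (rev (concat (orL k K I tt))) y v = (y v \<noteq> (\<exists>i<I. v = tt i \<and> (\<exists>j<K. y (ln k i j))))"
    proof (cases "\<exists>i<I. v = tt i")
      case True
      then obtain i where i: "i < I" "v = tt i" by auto
      have u: "(\<exists>i<I. v = tt i \<and> Q i) \<longleftrightarrow> Q i" for Q
        using i assms(1) by (auto simp: inj_on_def)
      have nl: "\<not> (\<exists>i<I. \<exists>j<K. v = ln k i j)" using i assms(2) by auto
      have "y2 v = (\<not> y v)" unfolding y2_def y1_def using nl True by blast
      moreover have "y3 v = (y2 v \<noteq> (\<forall>j<K. y2 (ln k i j)))" unfolding y3_def u ..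
      moreover have "(\<forall>j<K. y2 (ln k i j)) \<longleftrightarrow> \<not> (\<exists>j<K. y (ln k i j))" using y2l[OF i(1)] by auto
      ultimately show ?thesis unfolding cl u using nl by auto
    next
      case False
      then have "y3 v = y2 v" "y1 v = y v" by (auto simp: y3_def y1_def)
      then show ?thesis unfolding cl using False by (auto simp: y2_def)
    qed
  qed
  moreover have "classical g" if "g \<in> set (concat (orL k K I tt))" for g
    using that assms(2) by (auto simp: orL_def Let_def distinct_map inj_on_def)
  ultimately show ?thesis using run_classical[of "concat (orL k K I tt)" \<psi>] by simp
qed

lemma impl_or:
  assumes "inj_on tt {..<I}" "\<And>i i' j. i < I \<Longrightarrow> tt i \<noteq> ln k i' j"
    "\<And>i j. i < I \<Longrightarrow> j < K \<Longrightarrow> ln k i j \<in> L \<and> ln k i j \<in> W"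
    "\<And>i. i < I \<Longrightarrow> tt i \<in> L \<and> tt i \<in> W"
  shows "impl q S 4 L W (run (concat (orL k K I tt)))"
proof -
  have "impl q S (length (orL k K I tt)) L W (run (concat (orL k K I tt)))"
  proof (rule impl_layers)
    fix gs assume "gs \<in> set (orL k K I tt)"
    then consider (1) "gs = map (\<lambda>z. Toff [] (ln k (fst z) (snd z))) (List.product [0..<I] [0..<K])"
      | (2) "gs = map (\<lambda>i. Toff (map (ln k i) [0..<K]) (tt i)) [0..<I]"
      | (3) "gs = map (\<lambda>i. Toff [] (tt i)) [0..<I]" by (auto simp: orL_def Let_def)
    then show "pdisj gs \<and> (\<forall>g\<in>set gs. gin q S L W g)"
    proof cases
      case 1
      have "pdisj gs" unfolding 1 by (rule pdisj_map) (auto simp: distinct_product)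
      then show ?thesis using assms(3) by (auto simp: 1 gin_def gok_def)
    next
      case 2
      have "pdisj gs" unfolding 2
      proof (rule pdisj_map)
        fix i j assume ij: "i \<in> set [0..<I]" "j \<in> set [0..<I]" "i \<noteq> j"
        then have "tt i \<noteq> tt j" using assms(1) by (auto simp: inj_on_def)
        moreover have "tt i \<noteq> ln k i' j'" "tt j \<noteq> ln k i' j'" for i' j' using ij assms(2) by auto
        moreover from this have "ln k i' j' \<noteq> tt i" "ln k i' j' \<noteq> tt j" for i' j' by metis+
        ultimately show "set (glines (Toff (map (ln k i) [0..<K]) (tt i))) \<inter> set (glines (Toff (map (ln k j) [0..<K]) (tt j))) = {}"
          using ij by auto
      qed simp
      then show ?thesis using assms(2-4) by (auto simp: 2 gin_def gok_def distinct_map inj_on_def)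
    next
      case 3
      have "pdisj gs" unfolding 3 using assms(1) by (intro pdisj_map) (auto simp: inj_on_def)
      then show ?thesis using assms(4) by (auto simp: 3 gin_def gok_def)
    qed
  qed
  moreover have "length (orL k K I tt) = 4" by (simp add: orL_def Let_def)
  ultimately show ?thesis by (simp only:)
qed

section \<open>The phase of the digit sum from residue tests\<close>

definition bl :: "nat \<Rightarrow> nat list" where
  "bl i = map (ln 0 i) [0..<q - 1]"

definition us :: "nat list" where
  "us = concat (map (\<lambda>i. map (ln 1 i) [0..<q - 1]) [0..<length xs])"

text \<open>The \<open>j\<close> constant ones shift the count, so the MOD gate reports whether the
  digit sum plus \<open>j\<close> is not divisible by \<open>q\<close>. Its answer is negated and
  then joined with the line \<open>c\<close> to be copied.\<close>

definition sumL :: "nat \<Rightarrow> nat \<Rightarrow> gate list list" where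
  "sumL c j = [map (\<lambda>i. Toff [] (ln 6 0 i)) [0..<j], [ModG q (us @ map (ln 6 0) [0..<j]) (ln 4 0 0)],
     [Toff [] (ln 4 0 0)], [Toff [c, ln 4 0 0] (ln 5 0 0)]]"

lemma distinct_us: "distinct us"
proof -
  have "us = map (\<lambda>z. ln 1 (fst z) (snd z)) (List.product [0..<length xs] [0..<q - 1])"
    by (simp add: us_def product_concat_map map_concat comp_def)
  then show ?thesis by (simp add: distinct_map distinct_product inj_on_def prod_eq_iff)
qed

lemma set_us: "v \<in> set us \<longleftrightarrow> (\<exists>i<length xs. \<exists>l<q - 1. v = ln 1 i l)"
  unfolding us_def set_concat set_map set_upt by fastforce

lemma sumL_layer:
  assumes "gs \<in> set (sumL c j)" "j < q" "\<And>k i j. k < 7 \<Longrightarrow> c \<noteq> ln k i j"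
  shows "pdisj gs \<and> (\<forall>g\<in>set gs. gin q S (insert c (blk 7)) (blk 7) g \<and> classical g)"
proof -
  have c: "c \<noteq> ln 4 0 0" "c \<noteq> ln 5 0 0" using assms(3) by auto
  consider (1) "gs = map (\<lambda>i. Toff [] (ln 6 0 i)) [0..<j]"
    | (2) "gs = [ModG q (us @ map (ln 6 0) [0..<j]) (ln 4 0 0)]"
    | (3) "gs = [Toff [] (ln 4 0 0)]" | (4) "gs = [Toff [c, ln 4 0 0] (ln 5 0 0)]"
    using assms(1) by (auto simp: sumL_def)
  then show ?thesis
  proof cases
    case 1
    have "pdisj gs" unfolding 1 by (rule pdisj_map) auto
    then show ?thesis using assms(2) by (auto simp: 1 gin_def gok_def)
  next
    case 2
    have "distinct (us @ map (ln 6 0) [0..<j] @ [ln 4 0 0])"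
      using distinct_us by (auto simp: set_us distinct_map inj_on_def)
    moreover have "set (us @ map (ln 6 0) [0..<j] @ [ln 4 0 0]) \<subseteq> blk 7"
      using assms(2) q_ge by (auto simp: set_us)
    ultimately show ?thesis using p_ge by (auto simp: 2 gin_def gok_def pdisj_def)
  qed (use c p_ge in \<open>auto simp: gin_def gok_def pdisj_def\<close>)
qed

lemma cl_sumL:
  assumes "\<And>k i j. k < 7 \<Longrightarrow> c \<noteq> ln k i j"
    and z: "\<not> y (ln 4 0 0)" "\<not> y (ln 5 0 0)" "\<And>i. i < j \<Longrightarrow> \<not> y (ln 6 0 i)"
  shows "cl (concat (sumL c j)) y (ln 5 0 0) \<longleftrightarrow> y c \<and> q dvd length (filter id (map y us)) + j"
proof -
  define y1 where "y1 = (\<lambda>v. y v \<noteq> (\<exists>i<j. v = ln 6 0 i))"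
  have y1: "cl (map (\<lambda>i. Toff [] (ln 6 0 i)) [0..<j]) y = y1"
    by (subst cl_toffoli_block) (auto simp: inj_on_def y1_def fun_eq_iff)
  have c: "c \<noteq> ln 4 0 0" "c \<noteq> ln 5 0 0" "y1 c = y c" using assms(1) by (auto simp: y1_def)
  have m1: "map y1 us = map y us" by (auto simp: y1_def set_us)
  have m2: "map y1 (map (ln 6 0) [0..<j]) = replicate j True"
    by (rule nth_equalityI) (use z(3) in \<open>auto simp: y1_def\<close>)
  have "Modq q (map y1 (us @ map (ln 6 0) [0..<j])) \<longleftrightarrow> \<not> q dvd length (filter id (map y us)) + j"
    unfolding Modq_def map_append m1 m2 by (simp add: dvd_eq_mod_eq_0)
  moreover have "\<not> y1 (ln 4 0 0)" "\<not> y1 (ln 5 0 0)" using z by (auto simp: y1_def)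
  ultimately show ?thesis using c by (simp add: sumL_def y1 del: map_append map_map)
qed

text \<open>A MOD gate sees only the number of ones. The thermometer code turns every digit into
  that many ones, so the count is the digit sum.\<close>

lemma count_us:
  "length (filter id (map (\<lambda>v. y v \<noteq> (\<exists>l<q - 1. \<exists>i<length xs. v = ln 1 i l \<and> (\<forall>j\<le>l. y (ln 0 i j)))) us)) =
    (\<Sum>i<length xs. lead (bl i) y)"
  if z: "\<And>i l. i < length xs \<Longrightarrow> l < q - 1 \<Longrightarrow> \<not> y (ln 1 i l)"
proof -
  let ?y = "\<lambda>v. y v \<noteq> (\<exists>l<q - 1. \<exists>i<length xs. v = ln 1 i l \<and> (\<forall>j\<le>l. y (ln 0 i j)))"
  have a: "length (filter id (map ?y (map (ln 1 i) [0..<q - 1]))) = lead (bl i) y" if "i < length xs" for i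
  proof -
    have "map ?y (map (ln 1 i) [0..<q - 1]) = map (\<lambda>l. \<forall>j\<le>l. y (ln 0 i j)) [0..<q - 1]"
      using z that by auto
    then have "length (filter id (map ?y (map (ln 1 i) [0..<q - 1]))) =
       length (filter id (map (\<lambda>l. \<forall>j\<le>l. y (ln 0 i j)) [0..<q - 1]))" by (rule arg_cong)
    then show ?thesis unfolding bl_def lead_map_upt by (simp add: filter_map comp_def)
  qed
  have "length (filter id (map ?y us)) = (\<Sum>i\<leftarrow>[0..<length xs]. length (filter id (map ?y (map (ln 1 i) [0..<q - 1]))))"
    by (simp add: us_def map_concat filter_concat length_concat comp_def)
  also have "\<dots> = (\<Sum>i\<leftarrow>[0..<length xs]. lead (bl i) y)"
    by (intro arg_cong[where f = sum_list] map_cong refl a) auto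
  also have "\<dots> = (\<Sum>i<length xs. lead (bl i) y)"
    by (simp add: sum_list_distinct_conv_sum_set atLeast0LessThan)
  finally show ?thesis .
qed

text \<open>One unbounded fan-in test serves all registers, yet the resulting phase is a product
  over the registers; this is what lets each register be analysed alone. \<open>D\<close> is
  diagonal everywhere, while its value is given for clean auxiliary lines only.\<close>

lemma sum_phase:
  assumes c: "\<And>k i j. k < 7 \<Longrightarrow> c \<noteq> ln k i j"
  shows "\<exists>D. impl q S (2 * (q - 1) + q * 9) (insert c (blk 7)) (blk 7) (mul D) \<and>
    (\<forall>y. (\<forall>k\<in>{1,4,5,6}. \<forall>i\<le>length xs. \<forall>j<p + q. \<not> y (ln k i j)) \<longrightarrow>
      D y = (\<Prod>i<length xs. (if y c then rt q else 1) ^ lead (bl i) y))"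
proof -
  define f where "f j = (\<lambda>y. if cl (concat (sumL c j)) y (ln 5 0 0) then rt q ^ (q - j) else 1)" for j
  have f: "impl q S 9 (insert c (blk 7)) (blk 7) (mul (f j))" if "j < q" for j
  proof -
    have "impl q S 1 (insert c (blk 7)) (blk 7) (run [OneQ (ph (rt q ^ (q - j))) (ln 5 0 0)])"
      using ph_q p_ge by (intro impl_layer) (auto simp: pdisj_def gin_def gok_def)
    also have "run [OneQ (ph (rt q ^ (q - j))) (ln 5 0 0)] = mul (\<lambda>y. if y (ln 5 0 0) then rt q ^ (q - j) else 1)"
      by (simp add: app_ph del: app.simps)
    finally have "impl q S (2 * length (sumL c j) + 1) (insert c (blk 7)) (blk 7) (mul (f j))"
      unfolding f_def by (intro impl_conjugate) (use sumL_layer[OF _ that c] in auto)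
    \<comment> \<open>Four layers of the test, the phase, and four layers to undo the test. The
      \<open>q\<close> tests then run one after the other on the same work lines.\<close>
    moreover have "2 * length (sumL c j) + 1 = 9" by (simp add: sumL_def)
    ultimately show ?thesis by (simp only:)
  qed
  have "impl q S (length [0..<q] * 9) (insert c (blk 7)) (blk 7) (fold (\<lambda>j. mul (f j)) [0..<q])"
    by (rule impl_fold) (use f in auto)
  moreover have "fold (\<lambda>j. mul (f j)) [0..<q] = mul (\<lambda>y. \<Prod>j<q. f j y)"
    by (rule ext) (simp add: fold_mul prod.distinct_set_conv_list[symmetric] atLeast0LessThan)
  ultimately have i2: "impl q S (q * 9) (insert c (blk 7)) (blk 7) (mul (\<lambda>y. \<Prod>j<q. f j y))" by simp
  define T where "T = thermL 0 1 (length xs) (q - 1)"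
  define D where "D = (\<lambda>y. \<Prod>j<q. f j (cl (concat T) y))"
  have "impl q S (2 * length T + q * 9) (insert c (blk 7)) (blk 7) (mul D)"
    unfolding D_def by (rule impl_conjugate[OF _ i2], unfold T_def, rule therm_layer) auto
  then have "impl q S (2 * (q - 1) + q * 9) (insert c (blk 7)) (blk 7) (mul D)"
    by (simp add: T_def thermL_def)
  moreover have "D y = (\<Prod>i<length xs. (if y c then rt q else 1) ^ lead (bl i) y)"
    if y: "\<forall>k\<in>{1,4,5,6}. \<forall>i\<le>length xs. \<forall>j<p + q. \<not> y (ln k i j)" for y
  proof -
    define y1 where "y1 = cl (concat T) y"
    have y1: "y1 = (\<lambda>v. y v \<noteq> (\<exists>l<q - 1. \<exists>i<length xs. v = ln 1 i l \<and> (\<forall>j\<le>l. y (ln 0 i j))))"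
      unfolding y1_def T_def by (rule cl_therm) simp
    have o: "y1 (ln k i j) = y (ln k i j)" if "k \<noteq> 1" for k i j using that by (auto simp: y1)
    have yc: "y1 c = y c" using c by (auto simp: y1)
    have "f j y1 = (if y c \<and> q dvd (\<Sum>i<length xs. lead (bl i) y) + j then rt q ^ (q - j) else 1)" if "j < q" for j
    proof -
      have "length (filter id (map y1 us)) = (\<Sum>i<length xs. lead (bl i) y)"
        unfolding y1 by (rule count_us) (use y in auto)
      moreover have "\<not> y1 (ln 4 0 0)" "\<not> y1 (ln 5 0 0)" "\<And>i. i < j \<Longrightarrow> \<not> y1 (ln 6 0 i)"
        using y o p_ge that by auto
      ultimately show ?thesis unfolding f_def using cl_sumL[OF c] yc by simp
    qed
    then have "D y = (\<Prod>j<q. if y c \<and> q dvd (\<Sum>i<length xs. lead (bl i) y) + j then rt q ^ (q - j) else 1)"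
      unfolding D_def y1_def[symmetric] by simp
    also have "\<dots> = (if y c then rt q ^ (\<Sum>i<length xs. lead (bl i) y) else 1)"
      using q_ge by (intro prod_residue_phase) simp
    finally show ?thesis by (simp add: power_sum)
  qed
  ultimately show ?thesis by blast
qed

end

section \<open>Rotations of disjoint registers\<close>

definition onW :: "nat set \<Rightarrow> gate list \<Rightarrow> bool" where
  "onW W gs \<longleftrightarrow> (\<forall>g\<in>set gs. \<not> is_orc g \<and> glines g = [wr g] \<and> wr g \<in> W)"

lemma onW_append: "onW W (gs @ hs) \<longleftrightarrow> onW W gs \<and> onW W hs"
  by (auto simp: onW_def)

lemma onW_mono: "onW W gs \<Longrightarrow> W \<subseteq> V \<Longrightarrow> onW V gs"
  by (auto simp: onW_def)

lemma onW_commute: "onW W gs \<Longrightarrow> onW V hs \<Longrightarrow> W \<inter> V = {} \<Longrightarrow> run gs (run hs \<psi>) = run hs (run gs \<psi>)"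
  by (rule run_commute) (simp add: onW_def, metis disjoint_iff)

lemma onW_mul: "onW W gs \<Longrightarrow> indep W d \<Longrightarrow> run gs (mul d \<psi>) = mul d (run gs \<psi>)"
  by (rule run_mul) (auto simp: onW_def)

lemma onW_supp: "onW W gs \<Longrightarrow> supp P \<psi> \<Longrightarrow> indep W P \<Longrightarrow> supp P (run gs \<psi>)"
  by (rule run_supp) (auto simp: onW_def)

lemma onW_inverse: "onW W gs \<Longrightarrow> onW W (rev (map ginv gs))"
proof -
  have "is_orc (ginv g) = is_orc g" for g by (cases g) auto
  then show "onW W gs \<Longrightarrow> onW W (rev (map ginv gs))" by (auto simp: onW_def)
qed

lemma onW_Vg: "onW (set ls) (Vg ls)"
  using wr_Vg glines_Vg by (auto simp: onW_def)

lemma map_wr_Vg: "map wr (Vg ls) = ls"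
  by (induction ls) auto

lemma pdisj_onW: "onW W gs \<Longrightarrow> distinct (map wr gs) \<Longrightarrow> pdisj gs"
proof (induction gs)
  case (Cons g gs)
  then have "pdisj gs" by (auto simp: onW_def)
  moreover have "set (glines g) \<inter> set (glines h) = {}" if "h \<in> set gs" for h
  proof -
    have "glines g = [wr g]" "glines h = [wr h]" using Cons.prems(1) that by (auto simp: onW_def)
    moreover have "wr g \<noteq> wr h" using Cons.prems(2) that by auto
    ultimately show ?thesis by simp
  qed
  ultimately show ?case by (simp add: pdisj_def)
qed (simp add: pdisj_def)

lemma lead_upd: "l \<notin> set ls \<Longrightarrow> lead ls (y(l := b)) = lead ls y"
proof -
  assume "l \<notin> set ls"
  then have "takeWhile (y(l := b)) ls = takeWhile y ls" by (intro takeWhile_cong) auto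
  then show ?thesis by (simp add: lead_def)
qed

text \<open>Each \<open>Q l\<close> is known to be diagonal only on vectors supported in
  \<open>P\<close>. Diagonals preserve this support, so consecutive operators may use the same clean
  work lines.\<close>

lemma fold_diagonal:
  assumes "\<And>l \<psi>. l \<in> set ls \<Longrightarrow> supp P \<psi> \<Longrightarrow> Q l \<psi> = mul (f l) \<psi>" "supp P \<psi>"
  shows "fold Q ls \<psi> = mul (\<lambda>y. \<Prod>l\<leftarrow>ls. f l y) \<psi>"
  using assms
proof (induction ls arbitrary: \<psi>)
  case Nil
  then show ?case by (simp add: mul_def)
next
  case (Cons l ls)
  have "fold Q (l # ls) \<psi> = fold Q ls (mul (f l) \<psi>)" using Cons.prems by simp
  also have "\<dots> = mul (\<lambda>y. \<Prod>l\<leftarrow>ls. f l y) (mul (f l) \<psi>)"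
    by (rule Cons.IH) (use Cons.prems supp_mulI in auto)
  finally show ?case by (simp add: mul_mul mult.commute)
qed

text \<open>Preparing the copies takes 2(q-1) layers for the thermometer code and its removal, nine
  for each residue, two for the rotations and four for the disjunctions. It is done and undone
  around three layers that apply the phases.\<close>

definition fan_depth :: "nat \<Rightarrow> nat" where
  "fan_depth q = 2 * (2 * (q - 1) + q * 9 + 6) + 3"

text \<open>Two layers of rotations, the thermometer code and its removal, and one fan-out phase for
  each of its p-1 bits, all done and undone around the four layers that flip the target.\<close>

definition mod_depth :: "nat \<Rightarrow> nat \<Rightarrow> nat" where
  "mod_depth p q = 2 * (2 + 2 * (p - 1) + (p - 1) * fan_depth q) + 4"

section \<open>Copies of a line and the phases they control\<close>

context ancillas
begin

definition vl :: "gate list" where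
  "vl = concat (map (\<lambda>i. Vg (bl i)) [0..<length xs])"

lemma set_bl: "l \<in> set (bl i) \<longleftrightarrow> (\<exists>j<q - 1. l = ln 0 i j)"
  unfolding bl_def set_map set_upt by auto

lemma distinct_bl: "distinct (bl i)"
  by (simp add: bl_def distinct_map inj_on_def)

lemma onW_regs: "onW (\<Union>i\<in>set is. set (bl i)) (concat (map (\<lambda>i. Vg (bl i)) is))"
proof (induction "is")
  case (Cons i "is")
  then show ?case using onW_Vg[of "bl i"] by (simp add: onW_append) (meson onW_mono Un_upper1 Un_upper2)
qed (simp add: onW_def)

lemma impl_vl:
  "impl q S 1 (blk 7) (blk 7) (run vl)" "impl q S 1 (blk 7) (blk 7) (run (rev (map ginv vl)))"
proof -
  have mw: "map wr vl = map (\<lambda>z. ln 0 (fst z) (snd z)) (List.product [0..<length xs] [0..<q - 1])"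
    unfolding vl_def map_concat map_map comp_def map_wr_Vg
    by (simp add: bl_def product_concat_map map_concat comp_def)
  have d: "distinct (map wr vl)" unfolding mw
    by (simp add: distinct_map distinct_product inj_on_def prod_eq_iff)
  have o: "onW (blk 7) vl" unfolding vl_def
    by (rule onW_mono[OF onW_regs]) (auto simp: set_bl)
  have g: "gin q S (blk 7) (blk 7) g" if g: "g \<in> set vl" for g
  proof -
    obtain i where "g \<in> set (Vg (bl i))" using g by (auto simp: vl_def)
    then have "gok q S g" by (rule gok_Vg) (use Vm_S in \<open>auto simp: bl_def\<close>)
    then show ?thesis using o g by (auto simp: gin_def onW_def)
  qed
  show "impl q S 1 (blk 7) (blk 7) (run vl)" by (rule impl_layer[OF pdisj_onW[OF o d] g])
  have "map wr (rev (map ginv vl)) = rev (map wr vl)" by (simp add: rev_map comp_def)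
  then have "distinct (map wr (rev (map ginv vl)))" using d by (simp only: distinct_rev)
  then have "pdisj (rev (map ginv vl))" by (rule pdisj_onW[OF onW_inverse[OF o]])
  then show "impl q S 1 (blk 7) (blk 7) (run (rev (map ginv vl)))"
    by (rule impl_layer) (use g gin_ginv[OF _ usys] in auto)
qed

lemma rt_neq_1: "n \<ge> 2 \<Longrightarrow> rt n \<noteq> 1"
  using rt_power_eq_1[of n 1] by auto

text \<open>The rotations of the other registers and their factors of \<open>D\<close> commute with
  everything done to register \<open>i\<close>. They merely replace \<open>\<psi>\<close> by another
  vector in which register \<open>i\<close> is zero, and \<open>digit_test\<close> applies to that
  vector.\<close>

lemma fan_digit:
  assumes c: "\<And>k i j. k < 7 \<Longrightarrow> c \<noteq> ln k i j"
    and D: "\<And>y. \<forall>k\<in>{1,4,5,6}. \<forall>i\<le>length xs. \<forall>j<p + q. \<not> y (ln k i j) \<Longrightarrow>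
      D y = (\<Prod>i<length xs. (if y c then rt q else 1) ^ lead (bl i) y)"
    and \<psi>: "supp (\<lambda>y. \<forall>l\<in>blk 7. \<not> y l) \<psi>" and i: "i < length xs"
  shows "supp (\<lambda>y. (\<exists>l\<in>set (bl i). y l) \<longleftrightarrow> y c) (run (rev (map ginv vl)) (mul D (run vl \<psi>)))"
proof -
  define \<alpha> where "\<alpha> = (\<lambda>y. if y c then rt q else 1)"
  define al where "al = (\<lambda>y. \<alpha> y ^ lead (bl i) y)"
  define Do where "Do = (\<lambda>y. \<Prod>i'\<in>{..<length xs} - {i}. \<alpha> y ^ lead (bl i') y)"
  define R where "R = Vg (bl i)"
  define A where "A = concat (map (\<lambda>i. Vg (bl i)) [0..<i])"
  define B where "B = concat (map (\<lambda>i. Vg (bl i)) [Suc i..<length xs])"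
  define W where "W = (\<Union>i'\<in>{..<length xs} - {i}. set (bl i'))"
  have "[0..<length xs] = [0..<i] @ i # [Suc i..<length xs]"
    using i upt_add_eq_append[of 0 i "length xs - i"] upt_conv_Cons[of i "length xs"] by simp
  then have vl: "vl = A @ R @ B" by (simp add: vl_def A_def B_def R_def)
  have oR: "onW (set (bl i)) R" unfolding R_def by (rule onW_Vg)
  have oA: "onW W A" unfolding A_def by (rule onW_mono[OF onW_regs]) (use i in \<open>fastforce simp: W_def\<close>)
  have oB: "onW W B" unfolding B_def by (rule onW_mono[OF onW_regs]) (fastforce simp: W_def)
  have dj: "set (bl i) \<inter> W = {}" "W \<inter> set (bl i) = {}" by (auto simp: W_def set_bl)
  have cb: "c \<notin> set (bl i')" for i' using c by (auto simp: set_bl)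
  have oI: "onW W (rev (map ginv B) @ rev (map ginv A))"
    using onW_inverse oA oB by (simp add: onW_append)
  have r1: "run vl \<psi> = run R (run (A @ B) \<psi>)"
    using onW_commute[OF oB oR dj(2)] by (simp add: vl)
  have r2: "run (rev (map ginv vl)) \<phi> = run (rev (map ginv R)) (run (rev (map ginv B) @ rev (map ginv A)) \<phi>)" for \<phi>
    using onW_commute[OF onW_inverse[OF oA] onW_inverse[OF oR] dj(2)] by (simp add: vl)
  have Z: "supp (\<lambda>y. \<forall>k\<in>{1,4,5,6}. \<forall>i\<le>length xs. \<forall>j<p + q. \<not> y (ln k i j)) (run vl \<psi>)"
  proof (rule onW_supp[OF onW_regs[of "[0..<length xs]", folded vl_def]])
    show "supp (\<lambda>y. \<forall>k\<in>{1,4,5,6}. \<forall>i\<le>length xs. \<forall>j<p + q. \<not> y (ln k i j)) \<psi>"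
      by (rule supp_weaken[OF \<psi>]) auto
    show "indep (\<Union>i\<in>set [0..<length xs]. set (bl i)) (\<lambda>y. \<forall>k\<in>{1,4,5,6}. \<forall>i\<le>length xs. \<forall>j<p + q. \<not> y (ln k i j))"
      unfolding indep_def by (auto simp: set_bl)
  qed
  have iD: "indep (set (bl i)) Do"
    unfolding indep_def
  proof (intro allI impI)
    fix y l b assume l: "l \<in> set (bl i)"
    then have "l \<notin> set (bl i')" if "i' \<noteq> i" for i' using that by (auto simp: set_bl)
    moreover have "l \<noteq> c" using cb l by auto
    ultimately show "Do (y(l := b)) = Do y" by (simp add: Do_def \<alpha>_def lead_upd)
  qed
  have ia: "indep W al" unfolding indep_def
  proof (intro allI impI)
    fix y l b assume l: "l \<in> W"
    then have "l \<notin> set (bl i)" using dj by auto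
    moreover have "l \<noteq> c" using cb l by (auto simp: W_def)
    ultimately show "al (y(l := b)) = al y" by (simp add: al_def \<alpha>_def lead_upd)
  qed
  \<comment> \<open>The combined effect of all other registers: their rotations, their share
    \<open>Do\<close> of the phase, and the rotations back.\<close>
  define \<psi>' where "\<psi>' = run (rev (map ginv B) @ rev (map ginv A)) (mul Do (run (A @ B) \<psi>))"
  have "mul D (run vl \<psi>) = mul (\<lambda>y. al y * Do y) (run vl \<psi>)"
    by (rule mul_cong_supp[OF Z]) (use i in \<open>simp add: D al_def Do_def \<alpha>_def prod.remove[of _ i]\<close>)
  also have "\<dots> = mul al (run R (mul Do (run (A @ B) \<psi>)))"
    unfolding mul_mul[symmetric] r1 onW_mul[OF oR iD] ..
  finally have "run (rev (map ginv vl)) (mul D (run vl \<psi>)) = run (rev (map ginv R)) (mul al (run R \<psi>'))"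
    unfolding r2 \<psi>'_def onW_commute[OF oR oI dj(1)] by (simp only: onW_mul[OF oI ia])
  moreover have "supp (\<lambda>y. (\<exists>l\<in>set (bl i). y l) \<longleftrightarrow> \<alpha> y \<noteq> 1) (run (rev (map ginv R)) (mul al (run R \<psi>')))"
    unfolding R_def al_def
  proof (rule digit_test[OF distinct_bl])
    have zi: "indep W (\<lambda>y. \<forall>l\<in>set (bl i). \<not> y l)" by (rule indep_zero[OF dj(1)])
    have "supp (\<lambda>y. \<forall>l\<in>set (bl i). \<not> y l) \<psi>"
      by (rule supp_weaken[OF \<psi>]) (use i in \<open>auto simp: set_bl\<close>)
    then show "supp (\<lambda>y. \<forall>l\<in>set (bl i). \<not> y l) \<psi>'"
      unfolding \<psi>'_def using oA oB by (intro onW_supp[OF oI] supp_mulI onW_supp[where W = W] zi) (auto simp: onW_append)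
    show "indep (set (bl i)) \<alpha>" using cb by (auto simp: indep_def \<alpha>_def)
    show "\<alpha> y ^ (length (bl i) + 1) = 1" for y
      using q_ge rt_power_eq_1[of q q] by (simp add: \<alpha>_def bl_def)
  qed
  moreover have "\<alpha> y \<noteq> 1 \<longleftrightarrow> y c" for y using rt_neq_1[OF q_ge] by (simp add: \<alpha>_def)
  ultimately show ?thesis by simp
qed

abbreviation cnt :: "(nat \<Rightarrow> bool) \<Rightarrow> nat" where
  "cnt y \<equiv> length (filter id (map y xs))"

text \<open>Each input gets its own copy of \<open>c\<close>, so the phases for all inputs can be
  applied in a single layer. The copies are entangled with the registers and are removed by the
  inverse \<open>B'\<close>, which works because the total phase depends only on \<open>c\<close>
  and the inputs, lines that \<open>B\<close> does not write.\<close>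

lemma fan_phase:
  assumes c: "\<And>k i j. k < 7 \<Longrightarrow> c \<noteq> ln k i j" "c \<notin> set xs"
  shows "\<exists>Q. impl q S (fan_depth q) (insert c (set xs \<union> blk 7)) (blk 7) Q \<and>
    (\<forall>\<psi>. supp (\<lambda>y. \<forall>l\<in>blk 7. \<not> y l) \<psi> \<longrightarrow> Q \<psi> = mul (\<lambda>y. if y c then rt p ^ cnt y else 1) \<psi>)"
proof -
  let ?L = "insert c (set xs \<union> blk 7)"
  obtain D where Di: "impl q S (2 * (q - 1) + q * 9) (insert c (blk 7)) (blk 7) (mul D)"
    and D: "\<And>y. \<forall>k\<in>{1,4,5,6}. \<forall>i\<le>length xs. \<forall>j<p + q. \<not> y (ln k i j) \<Longrightarrow>
      D y = (\<Prod>i<length xs. (if y c then rt q else 1) ^ lead (bl i) y)"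
    using sum_phase[OF c(1)] by blast
  define Op where "Op = run (concat (orL 0 (q - 1) (length xs) (\<lambda>i. ln 2 i 0)))"
  define B where "B = (\<lambda>\<psi>. Op (run (rev (map ginv vl)) (mul D (run vl \<psi>))))"
  have Oi: "impl q S 4 ?L (blk 7) Op" unfolding Op_def using p_ge by (intro impl_or) (auto simp: inj_on_def)
  have "impl q S (1 + (2 * (q - 1) + q * 9) + 1 + 4) ?L (blk 7) B" unfolding B_def
    by (intro impl_seq impl_subset[OF impl_vl(1)] impl_subset[OF impl_vl(2)] impl_subset[OF Di] Oi) auto
  then have Bi: "impl q S (2 * (q - 1) + q * 9 + 6) ?L (blk 7) B" by (simp add: algebra_simps)
  obtain B' where B'i: "impl q S (2 * (q - 1) + q * 9 + 6) ?L (blk 7) B'" and B': "\<And>\<psi>. B' (B \<psi>) = \<psi>"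
    using impl_inverse[OF Bi usys] by blast
  let ?T = "map (\<lambda>i. Toff [ln 2 i 0, xs ! i] (ln 3 i 0)) [0..<length xs]"
  let ?P = "map (\<lambda>i. OneQ (ph (rt p)) (ln 3 i 0)) [0..<length xs]"
  have ne: "ln k i j \<noteq> xs ! i'" "xs ! i' \<noteq> ln k i j" if "i' < length xs" for k i j i'
    using ln_xs nth_mem[OF that] by metis+
  have tL: "pdisj ?T \<and> (\<forall>g\<in>set ?T. gin q S ?L (blk 7) g \<and> classical g)"
  proof
    show "pdisj ?T"
      by (rule pdisj_map) (use ne xs in \<open>auto simp: nth_eq_iff_index_eq\<close>)
    show "\<forall>g\<in>set ?T. gin q S ?L (blk 7) g \<and> classical g"
      using ne p_ge by (auto simp: gin_def gok_def)
  qed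
  have "run ?P = fold (\<lambda>i. mul (\<lambda>y. if y (ln 3 i 0) then rt p else 1)) [0..<length xs]"
    unfolding fold_map comp_def app_ph ..
  also have "\<dots> = mul (\<lambda>y. \<Prod>i<length xs. if y (ln 3 i 0) then rt p else 1)"
    by (rule ext) (simp add: fold_mul prod.distinct_set_conv_list[symmetric] atLeast0LessThan)
  finally have rP: "run ?P = mul (\<lambda>y. \<Prod>i<length xs. if y (ln 3 i 0) then rt p else 1)" .
  have "impl q S 1 ?L (blk 7) (run ?P)"
  proof (rule impl_layer)
    show "pdisj ?P" by (rule pdisj_map) auto
    show "\<And>g. g \<in> set ?P \<Longrightarrow> gin q S ?L (blk 7) g" using ph_p p_ge by (auto simp: gin_def gok_def)
  qed
  then have "impl q S (2 * length [?T] + 1) ?L (blk 7) (mul (\<lambda>y. \<Prod>i<length xs. if cl (concat [?T]) y (ln 3 i 0) then rt p else 1))"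
    unfolding rP by (intro impl_conjugate) (use tL in auto)
  then have Pi: "impl q S 3 ?L (blk 7) (mul (\<lambda>y. \<Prod>i<length xs. if cl ?T y (ln 3 i 0) then rt p else 1))"
    (is "impl _ _ _ _ _ (mul ?f)") by (simp add: numeral_3_eq_3)
  let ?Q = "\<lambda>\<psi>. B' (mul ?f (B \<psi>))"
  have "impl q S (2 * (q - 1) + q * 9 + 6 + 3 + (2 * (q - 1) + q * 9 + 6)) ?L (blk 7) ?Q"
    by (intro impl_seq Bi Pi B'i)
  then have "impl q S (fan_depth q) ?L (blk 7) ?Q" by (simp add: fan_depth_def algebra_simps mult_2)
  moreover have "?Q \<psi> = mul (\<lambda>y. if y c then rt p ^ cnt y else 1) \<psi>"
    if \<psi>: "supp (\<lambda>y. \<forall>l\<in>blk 7. \<not> y l) \<psi>" for \<psi>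
  proof (rule conjugate_diagonal[OF Bi B'])
    show "indep (blk 7) (\<lambda>y. if y c then rt p ^ cnt y else 1)"
    proof -
      have "l \<noteq> c \<and> l \<notin> set xs" if "l \<in> blk 7" for l using that c by (auto simp: blk_def)
      then show ?thesis unfolding indep_def by (auto simp: map_fun_upd_notin simp del: map_fun_upd)
    qed
    \<comment> \<open>The state just before the disjunctions, when each register is nonzero exactly
      if \<open>c\<close> is set.\<close>
    define \<chi> where "\<chi> = run (rev (map ginv vl)) (mul D (run vl \<psi>))"
    have B\<chi>: "B \<psi> = (\<lambda>y. \<chi> (\<lambda>v. y v \<noteq> (\<exists>i<length xs. v = ln 2 i 0 \<and> (\<exists>j<q - 1. y (ln 0 i j)))))"
      unfolding B_def \<chi>_def Op_def by (subst run_or) (auto simp: inj_on_def)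
    have on: "onW (\<Union>i\<in>{..<length xs}. set (bl i)) vl"
      using onW_regs[of "[0..<length xs]"] by (simp add: vl_def atLeast0LessThan)
    \<comment> \<open>Up to this point only register lines have been rotated and a diagonal applied,
      so the lines for copies and conjunctions are still zero.\<close>
    have z23: "supp (\<lambda>y. \<forall>k\<in>{2,3}. \<forall>i\<le>length xs. \<not> y (ln k i 0)) \<chi>"
      unfolding \<chi>_def
    proof (intro onW_supp[OF onW_inverse[OF on]] supp_mulI onW_supp[OF on])
      show "supp (\<lambda>y. \<forall>k\<in>{2,3}. \<forall>i\<le>length xs. \<not> y (ln k i 0)) \<psi>"
        by (rule supp_weaken[OF \<psi>]) (use p_ge in auto)
    qed (auto simp: indep_def set_bl)
    have sp: "y (ln 2 i 0) = y c \<and> \<not> y (ln 3 i 0)" if nz: "B \<psi> y \<noteq> 0" and i: "i < length xs" for y i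
    proof -
      \<comment> \<open>The assignment before the disjunctions that is carried to \<open>y\<close>;
        the known facts hold there and are transported to \<open>y\<close>.\<close>
      define y' where "y' = (\<lambda>v. y v \<noteq> (\<exists>i<length xs. v = ln 2 i 0 \<and> (\<exists>j<q - 1. y (ln 0 i j))))"
      have nz': "\<chi> y' \<noteq> 0" using nz B\<chi> by (simp add: y'_def)
      have o: "y' (ln k i j) = y (ln k i j)" if "k \<noteq> 2" for k i j using that by (simp add: y'_def)
      have yc: "y' c = y c" using c(1)[of 2] by (simp add: y'_def)
      have "(\<exists>l\<in>set (bl i). y' l) \<longleftrightarrow> y' c"
        using fan_digit[OF c(1) D \<psi> i] nz' unfolding \<chi>_def supp_def by blast
      then have or: "(\<exists>j<q - 1. y (ln 0 i j)) \<longleftrightarrow> y c"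
      proof -
        have "set (bl i) = ln 0 i ` {..<q - 1}" by (auto simp: bl_def atLeast0LessThan)
        then have "(\<exists>l\<in>set (bl i). y' l) \<longleftrightarrow> (\<exists>j<q - 1. y (ln 0 i j))" by (simp add: o Bex_def)
        then show "(\<exists>l\<in>set (bl i). y' l) = y' c \<Longrightarrow> ?thesis" by (simp only: yc)
      qed
      have "\<not> y' (ln 2 i 0)" "\<not> y' (ln 3 i 0)" using z23 nz' i unfolding supp_def by auto
      moreover have "y' (ln 2 i 0) = (y (ln 2 i 0) \<noteq> (\<exists>j<q - 1. y (ln 0 i j)))"
        using i by (simp add: y'_def)
      ultimately show ?thesis using or o[of 3 i 0] by auto
    qed
    then have "supp (\<lambda>y. \<forall>i<length xs. y (ln 2 i 0) = y c \<and> \<not> y (ln 3 i 0)) (B \<psi>)"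
      unfolding supp_def by blast
    then show "mul ?f (B \<psi>) = mul (\<lambda>y. if y c then rt p ^ cnt y else 1) (B \<psi>)"
    proof (rule mul_cong_supp)
      fix y assume y: "\<forall>i<length xs. y (ln 2 i 0) = y c \<and> \<not> y (ln 3 i 0)"
      have T: "cl ?T y = (\<lambda>v. y v \<noteq> (\<exists>i\<in>set [0..<length xs]. v = ln 3 i 0 \<and> (\<forall>c\<in>set [ln 2 i 0, xs ! i]. y c)))"
        by (rule cl_toffoli_block) (use ne in \<open>auto simp: inj_on_def\<close>)
      have "cl ?T y (ln 3 i 0) \<longleftrightarrow> y c \<and> y (xs ! i)" if "i < length xs" for i
        unfolding T using y that by auto
      then have "?f y = (\<Prod>i<length xs. if y c \<and> y (xs ! i) then rt p else 1)"
        by (intro prod.cong) auto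
      also have "\<dots> = (if y c then rt p ^ cnt y else 1)"
        using prod_power_count[of y xs "rt p"] by simp
      finally show "?f y = (if y c then rt p ^ cnt y else 1)" .
    qed
  qed
  ultimately show ?thesis by blast
qed

section \<open>The MOD gate of another modulus\<close>

text \<open>On the support of \<open>A \<psi>\<close> the register is nonzero exactly when the MOD
  gate would flip \<open>t\<close>, so \<open>M\<close> may be replaced by that gate. The gate
  commutes with \<open>A\<close>, which reads the inputs but neither writes them nor touches
  \<open>t\<close>; then \<open>A'\<close> cancels \<open>A\<close> and leaves the bare MOD
  gate.\<close>

lemma mod_gadget:
  assumes t: "t \<notin> set xs" "\<And>k i j. ln k i j \<noteq> t"
  shows "\<exists>A. impl q S (mod_depth p q) (insert t (set xs \<union> blk 9)) (insert t (blk 9)) A \<and>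
    (\<forall>\<psi>. supp (\<lambda>y. \<forall>l\<in>blk 9. \<not> y l) \<psi> \<longrightarrow> A \<psi> = app (ModG p xs t) \<psi>)"
proof -
  let ?L = "set xs \<union> blk 9"
  define rl where "rl = map (ln 7 0) [0..<p - 1]"
  have rl: "set rl = ln 7 0 ` {..<p - 1}" "distinct rl" "length rl = p - 1"
    by (auto simp: rl_def atLeast0LessThan distinct_map inj_on_def)
  have b79: "blk 7 \<subseteq> blk 9" by (auto simp: blk_def)
  \<comment> \<open>All p-1 thermometer bits use the same work lines \<open>blk 7\<close>, one bit
    after the other.\<close>
  have "\<forall>l. \<exists>Q. impl q S (fan_depth q) (insert (ln 8 0 l) (set xs \<union> blk 7)) (blk 7) Q \<and>
    (\<forall>\<psi>. supp (\<lambda>y. \<forall>l\<in>blk 7. \<not> y l) \<psi> \<longrightarrow> Q \<psi> = mul (\<lambda>y. if y (ln 8 0 l) then rt p ^ cnt y else 1) \<psi>)"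
    by (intro allI fan_phase) auto
  from choice[OF this] obtain Q where Qi: "\<And>l. impl q S (fan_depth q) (insert (ln 8 0 l) (set xs \<union> blk 7)) (blk 7) (Q l)"
    and Q: "\<And>l \<psi>. supp (\<lambda>y. \<forall>l\<in>blk 7. \<not> y l) \<psi> \<Longrightarrow> Q l \<psi> = mul (\<lambda>y. if y (ln 8 0 l) then rt p ^ cnt y else 1) \<psi>"
    by blast
  define T where "T = thermL 7 8 1 (p - 1)"
  have TL: "pdisj gs \<and> (\<forall>g\<in>set gs. gin q S ?L (blk 9) g \<and> classical g)" if "gs \<in> set T" for gs
    using that unfolding T_def by (rule therm_layer) auto
  have lT: "length T = p - 1" by (simp add: T_def thermL_def)
  have Ti: "impl q S (p - 1) ?L (blk 9) (run (concat T))"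
    using impl_layers[of T q S ?L "blk 9"] TL lT by auto
  have "pdisj (rev gs) = pdisj gs" for gs unfolding pdisj_def by (simp add: sorted_wrt_rev Int_commute)
  then have "impl q S (length (rev (map rev T))) ?L (blk 9) (run (concat (rev (map rev T))))"
    using TL by (intro impl_layers) auto
  then have T'i: "impl q S (p - 1) ?L (blk 9) (run (rev (concat T)))" by (simp add: rev_concat rev_map lT)
  have onR: "onW (set rl) (Vg rl)" by (rule onW_Vg)
  have gR: "gin q S ?L (blk 9) g" if g: "g \<in> set (Vg rl)" for g
  proof -
    have "gok q S g" using g by (rule gok_Vg) (use Vm_S rl(3) in auto)
    moreover have "glines g = [wr g]" "wr g \<in> set rl" using onR g by (auto simp: onW_def)
    ultimately show ?thesis using rl(1) by (auto simp: gin_def)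
  qed
  have Vi: "impl q S 1 ?L (blk 9) (run (Vg rl))"
    by (rule impl_layer[OF pdisj_onW[OF onR]]) (use gR rl(2) map_wr_Vg in auto)
  have "map wr (rev (map ginv (Vg rl))) = rev (map wr (Vg rl))" by (simp add: rev_map comp_def)
  then have "distinct (map wr (rev (map ginv (Vg rl))))" using rl(2) by (simp only: distinct_rev map_wr_Vg)
  then have V'i: "impl q S 1 ?L (blk 9) (run (rev (map ginv (Vg rl))))"
    by (intro impl_layer pdisj_onW[OF onW_inverse[OF onR]]) (use gR gin_ginv[OF _ usys] in auto)
  have "impl q S (length [0..<p - 1] * fan_depth q) ?L (blk 9) (fold Q [0..<p - 1])"
  proof (rule impl_fold)
    fix l assume "l \<in> set [0..<p - 1]"
    then show "impl q S (fan_depth q) ?L (blk 9) (Q l)" using b79 by (intro impl_subset[OF Qi]) auto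
  qed
  then have Fi: "impl q S ((p - 1) * fan_depth q) ?L (blk 9) (fold Q [0..<p - 1])" by simp
  define A where "A = (\<lambda>\<psi>. run (rev (map ginv (Vg rl))) (run (rev (concat T)) (fold Q [0..<p - 1] (run (concat T) (run (Vg rl) \<psi>)))))"
  have "impl q S (1 + (p - 1) + (p - 1) * fan_depth q + (p - 1) + 1) ?L (blk 9) A"
    unfolding A_def by (intro impl_seq Vi V'i Ti T'i Fi)
  moreover have "1 + (p - 1) + (p - 1) * fan_depth q + (p - 1) + 1 = 2 + 2 * (p - 1) + (p - 1) * fan_depth q" by simp
  ultimately have Ai: "impl q S (2 + 2 * (p - 1) + (p - 1) * fan_depth q) ?L (blk 9) A" by (simp only:)
  obtain A' where A'i: "impl q S (2 + 2 * (p - 1) + (p - 1) * fan_depth q) ?L (blk 9) A'"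
    and A': "\<And>\<psi>. A' (A \<psi>) = \<psi>" using impl_inverse[OF Ai usys] by blast
  define M where "M = run (concat (orL 7 (p - 1) 1 (\<lambda>_. t)))"
  have Mi: "impl q S 4 (insert t ?L) (insert t (blk 9)) M"
    unfolding M_def using t by (intro impl_or) (auto simp: inj_on_def dest: sym)
  have "impl q S (2 + 2 * (p - 1) + (p - 1) * fan_depth q + 4 + (2 + 2 * (p - 1) + (p - 1) * fan_depth q))
     (insert t ?L) (insert t (blk 9)) (\<lambda>\<psi>. A' (M (A \<psi>)))"
    by (intro impl_seq impl_subset[OF Ai] impl_subset[OF A'i] Mi) auto
  then have "impl q S (mod_depth p q) (insert t ?L) (insert t (blk 9)) (\<lambda>\<psi>. A' (M (A \<psi>)))"
    by (rule impl_mono) (simp_all add: mod_depth_def)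
  moreover have "A' (M (A \<psi>)) = app (ModG p xs t) \<psi>" if \<psi>: "supp (\<lambda>y. \<forall>l\<in>blk 9. \<not> y l) \<psi>" for \<psi>
  proof -
    define \<phi> where "\<phi> = run (Vg rl) \<psi>"
    have z8: "supp (\<lambda>y. (\<forall>l\<in>blk 7. \<not> y l) \<and> (\<forall>j<p. \<not> y (ln 8 0 j))) \<phi>"
      unfolding \<phi>_def
    proof (rule onW_supp[OF onR])
      show "supp (\<lambda>y. (\<forall>l\<in>blk 7. \<not> y l) \<and> (\<forall>j<p. \<not> y (ln 8 0 j))) \<psi>"
        by (rule supp_weaken[OF \<psi>]) (use b79 in auto)
      show "indep (set rl) (\<lambda>y. (\<forall>l\<in>blk 7. \<not> y l) \<and> (\<forall>j<p. \<not> y (ln 8 0 j)))"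
        by (auto simp: indep_def rl(1) blk_def)
    qed
    \<comment> \<open>The thermometer code writes only lines of role 8, so the lines needed for
      copying are still clean.\<close>
    have "supp (\<lambda>y. \<forall>l\<in>blk 7. \<not> y l) (run (concat T) \<phi>)"
    proof (rule run_supp)
      show "supp (\<lambda>y. \<forall>l\<in>blk 7. \<not> y l) \<phi>" by (rule supp_weaken[OF z8]) auto
      show "indep {ln 8 0 j |j. True} (\<lambda>y. \<forall>l\<in>blk 7. \<not> y l)" by (auto simp: indep_def blk_def)
      show "\<not> is_orc g \<and> wr g \<in> {ln 8 0 j |j. True}" if "g \<in> set (concat T)" for g
        using that by (auto simp: T_def thermL_def)
    qed
    then have "fold Q [0..<p - 1] (run (concat T) \<phi>) =
      mul (\<lambda>y. \<Prod>l\<leftarrow>[0..<p - 1]. if y (ln 8 0 l) then rt p ^ cnt y else 1) (run (concat T) \<phi>)"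
      by (intro fold_diagonal[where P = "\<lambda>y. \<forall>l\<in>blk 7. \<not> y l"] Q)
    then have "run (rev (concat T)) (fold Q [0..<p - 1] (run (concat T) \<phi>)) =
      mul (\<lambda>y. \<Prod>l\<leftarrow>[0..<p - 1]. if cl (concat T) y (ln 8 0 l) then rt p ^ cnt (cl (concat T) y) else 1) \<phi>"
      using TL by (simp only:) (intro run_rev_mul, auto)
    \<comment> \<open>Each thermometer bit that is set contributes one factor, and their number is
      the digit.\<close>
    also have "\<dots> = mul (\<lambda>y. (rt p ^ cnt y) ^ lead rl y) \<phi>"
    proof (rule mul_cong_supp[OF z8])
      fix y assume y: "(\<forall>l\<in>blk 7. \<not> y l) \<and> (\<forall>j<p. \<not> y (ln 8 0 j))"
      have clT: "cl (concat T) y = (\<lambda>v. y v \<noteq> (\<exists>l<p - 1. \<exists>i<1. v = ln 8 i l \<and> (\<forall>j\<le>l. y (ln 7 i j))))"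
        unfolding T_def by (rule cl_therm) simp
      have "map (cl (concat T) y) xs = map y xs" unfolding clT
      proof (rule map_cong[OF refl])
        fix x assume "x \<in> set xs"
        then have "x \<noteq> ln k i j" for k i j using ln_xs by metis
        then show "(y x \<noteq> (\<exists>l<p - 1. \<exists>i<1. x = ln 8 i l \<and> (\<forall>j\<le>l. y (ln 7 i j)))) = y x" by simp
      qed
      moreover have "cl (concat T) y (ln 8 0 l) \<longleftrightarrow> (\<forall>j\<le>l. y (ln 7 0 j))" if "l < p - 1" for l
        unfolding clT using y that by auto
      ultimately have "(\<Prod>l\<leftarrow>[0..<p - 1]. if cl (concat T) y (ln 8 0 l) then rt p ^ cnt (cl (concat T) y) else 1) =
         (\<Prod>l\<leftarrow>[0..<p - 1]. if \<forall>j\<le>l. y (ln 7 0 j) then rt p ^ cnt y else 1)"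
        by (intro arg_cong[where f = prod_list] map_cong refl) (auto simp del: map_eq_conv)
      also have "\<dots> = (rt p ^ cnt y) ^ length (filter (\<lambda>l. \<forall>j\<le>l. y (ln 7 0 j)) [0..<p - 1])"
      proof -
        have "(\<Prod>l\<leftarrow>ls. if R l then a else 1) = a ^ length (filter R ls)" for R ls and a :: complex
          by (induction ls) auto
        then show ?thesis .
      qed
      also have "\<dots> = (rt p ^ cnt y) ^ lead rl y" by (simp add: rl_def lead_map_upt)
      finally show "(\<Prod>l\<leftarrow>[0..<p - 1]. if cl (concat T) y (ln 8 0 l) then rt p ^ cnt (cl (concat T) y) else 1) =
         (rt p ^ cnt y) ^ lead rl y" .
    qed
    finally have A\<psi>: "A \<psi> = run (rev (map ginv (Vg rl))) (mul (\<lambda>y. (rt p ^ cnt y) ^ lead rl y) (run (Vg rl) \<psi>))"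
      unfolding A_def \<phi>_def by simp
    have "supp (\<lambda>y. (\<exists>l\<in>set rl. y l) \<longleftrightarrow> rt p ^ cnt y \<noteq> 1) (A \<psi>)"
      unfolding A\<psi>
    proof (rule digit_test[OF rl(2)])
      show "supp (\<lambda>y. \<forall>l\<in>set rl. \<not> y l) \<psi>"
        by (rule supp_weaken[OF \<psi>]) (use rl(1) in auto)
      show "indep (set rl) (\<lambda>y. rt p ^ cnt y)"
        unfolding indep_def
      proof (intro allI impI)
        fix y :: "nat \<Rightarrow> bool" and l b assume "l \<in> set rl"
        then have "l \<notin> set xs" by (auto simp: rl(1))
        then have "map (y(l := b)) xs = map y xs" by (rule map_fun_upd_notin)
        then show "rt p ^ cnt (y(l := b)) = rt p ^ cnt y" by (simp only:)
      qed
      show "(rt p ^ cnt y) ^ (length rl + 1) = 1" for y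
        using p_ge rl(3) by (simp add: rt_power_eq_1 flip: power_mult)
    qed
    then have sA: "(\<exists>j<p - 1. y (ln 7 0 j)) \<longleftrightarrow> Modq p (map y xs)" if "A \<psi> y \<noteq> 0" for y
    proof -
      have "(\<exists>l\<in>set rl. y l) \<longleftrightarrow> (\<exists>j<p - 1. y (ln 7 0 j))" unfolding rl(1) by auto
      moreover have "rt p ^ cnt y \<noteq> 1 \<longleftrightarrow> Modq p (map y xs)"
        using p_ge rt_power_eq_1[of p "cnt y"] by (simp add: Modq_def dvd_eq_mod_eq_0)
      ultimately show ?thesis using \<open>supp _ (A \<psi>)\<close> that unfolding supp_def by blast
    qed
    have MA: "M (A \<psi>) = app (ModG p xs t) (A \<psi>)"
    proof
      fix y
      define R where "R \<longleftrightarrow> (\<exists>j<p - 1. y (ln 7 0 j))"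
      have "M (A \<psi>) y = A \<psi> (\<lambda>v. y v \<noteq> (\<exists>i<1. v = t \<and> (\<exists>j<p - 1. y (ln 7 i j))))"
        unfolding M_def by (subst run_or) (use t in \<open>auto simp: inj_on_def dest: sym\<close>)
      also have "(\<lambda>v. y v \<noteq> (\<exists>i<1. v = t \<and> (\<exists>j<p - 1. y (ln 7 i j)))) = y(t := (y t \<noteq> R))"
        by (auto simp: fun_eq_iff R_def)
      finally have M: "M (A \<psi>) y = A \<psi> (y(t := (y t \<noteq> R)))" .
      have eqs: "(\<exists>j<p - 1. (y(t := b)) (ln 7 0 j)) = R" "map (y(t := b)) xs = map y xs" for b
        using t by (auto simp: R_def)
      show "M (A \<psi>) y = app (ModG p xs t) (A \<psi>) y"
      proof (cases "R = Modq p (map y xs)")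
        case True
        then show ?thesis using M by simp
      next
        case False
        \<comment> \<open>Neither condition looks at \<open>t\<close>. Where they disagree, both
          values of \<open>t\<close> lie outside the support, so it does not matter whether
          \<open>t\<close> is flipped.\<close>
        then have "A \<psi> (y(t := b)) = 0" for b using sA[of "y(t := b)"] eqs[of b] by metis
        then show ?thesis using M by simp
      qed
    qed
    also have "\<dots> = A (app (ModG p xs t) \<psi>)"
    proof -
      have "t \<notin> blk 9" using t(2) by (force simp: blk_def)
      moreover have "blk 9 \<inter> set xs = {}" by (auto simp: blk_def)
      ultimately show ?thesis using t(1) by (intro impl_app_commute[OF Ai, symmetric]) auto
    qed
    finally show ?thesis using A' by simp
  qed
  ultimately show ?thesis by auto
qed

end

section \<open>Simulation of circuits\<close>

text \<open>Every gate owns work lines indexed by its target \<open>t\<close>; gates of one layer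
  have distinct targets, so their blocks are disjoint. The Cantor pairing packs the four indices
  injectively and with only polynomial growth.\<close>

definition anc :: "nat \<Rightarrow> nat \<Rightarrow> nat \<Rightarrow> nat \<Rightarrow> nat \<Rightarrow> nat" where
  "anc N t k i j = N + prod_encode (t, prod_encode (k, prod_encode (i, j)))"

definition anc_block :: "nat \<Rightarrow> nat \<Rightarrow> nat \<Rightarrow> nat set" where
  "anc_block c N t = {anc N t k i j |k i j. k < 9 \<and> i \<le> N \<and> j < c}"

text \<open>The quadratic bound on the Cantor pairing, nested once for each of the three
  pairings.\<close>

definition anc_count :: "nat \<Rightarrow> nat \<Rightarrow> nat" where
  "anc_count c N = (N + (9 + (N + c + 1)\<^sup>2 + 1)\<^sup>2 + 1)\<^sup>2"

lemma anc_inj [simp]: "anc N t k i j = anc N t' k' i' j' \<longleftrightarrow> t = t' \<and> k = k' \<and> i = i' \<and> j = j'"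
  by (auto simp: anc_def prod_encode_eq)

lemma prod_encode_less: "a \<le> A \<Longrightarrow> b \<le> B \<Longrightarrow> prod_encode (a, b) < (A + B + 1)\<^sup>2"
proof -
  assume "a \<le> A" "b \<le> B"
  have t: "2 * triangle n = n * (n + 1)" for n by (induction n) auto
  have "2 * prod_encode (a, b) \<le> (a + b) * (a + b + 1) + 2 * (a + b)"
    using t[of "a + b"] by (simp add: prod_encode_def)
  also have "\<dots> < 2 * (a + b + 1)\<^sup>2" by (simp add: power2_eq_square algebra_simps)
  also have "\<dots> \<le> 2 * (A + B + 1)\<^sup>2" using \<open>a \<le> A\<close> \<open>b \<le> B\<close> by (intro mult_left_mono power_mono) auto
  finally show ?thesis by simp
qed

lemma anc_block_less:
  assumes "t < N"
  shows "anc_block c N t \<subseteq> {..<N + anc_count c N}"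
proof -
  have "anc N t k i j < N + anc_count c N" if "k < 9" "i \<le> N" "j < c" for k i j
  proof -
    have "prod_encode (i, j) < (N + c + 1)\<^sup>2" using that by (intro prod_encode_less) auto
    then have "prod_encode (k, prod_encode (i, j)) < (9 + (N + c + 1)\<^sup>2 + 1)\<^sup>2"
      using that by (intro prod_encode_less) auto
    then show ?thesis using assms unfolding anc_def anc_count_def
      by (intro add_strict_left_mono prod_encode_less) auto
  qed
  then show ?thesis by (auto simp: anc_block_def)
qed

text \<open>MOD gates are replaced by the gadget. All other gates are kept and padded to the same
  depth, so that the simulations of a whole layer can run in parallel.\<close>

lemma (in mod_gates) gate_simulation:
  assumes g: "gate_wf (\<lambda>_. 0) N g" "qaccq_gate p g" "\<And>U i. g = OneQ U i \<Longrightarrow> U \<in> S0"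
  shows "\<exists>A. impl q (S0 \<union> S) (mod_depth p q) (set (glines g) \<union> anc_block (p + q) N (wr g)) UNIV A \<and>
    (\<forall>\<psi>. supp (\<lambda>y. \<forall>l\<ge>N. \<not> y l) \<psi> \<longrightarrow> A \<psi> = app g \<psi>)"
proof (cases "\<exists>ys t. g = ModG p ys t")
  case True
  then obtain ys t where gg: "g = ModG p ys t" by auto
  have wf: "distinct ys" "t \<notin> set ys" "\<forall>i\<in>set ys. i < N" "t < N" using g(1) by (auto simp: gg gate_wf_def)
  have ge: "anc N t k i j \<ge> N" for k i j by (simp add: anc_def)
  interpret ancillas p q S "anc N t" ys
    by unfold_locales (use wf ge in \<open>auto simp: not_le[symmetric]\<close>)
  have "length ys \<le> N"
  proof -
    have "card (set ys) \<le> card {..<N}" using wf by (intro card_mono) auto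
    then show ?thesis using wf by (simp add: distinct_card)
  qed
  then have sub: "blk 9 \<subseteq> anc_block (p + q) N t" by (auto simp: blk_def anc_block_def)
  have nt: "anc N t k i j \<noteq> t" for k i j using ge[of k i j] wf by auto
  obtain A where A: "impl q S (mod_depth p q) (insert t (set ys \<union> blk 9)) (insert t (blk 9)) A"
    "\<And>\<psi>. supp (\<lambda>y. \<forall>l\<in>blk 9. \<not> y l) \<psi> \<Longrightarrow> A \<psi> = app (ModG p ys t) \<psi>"
    using mod_gadget[OF wf(2) nt] by blast
  have "impl q (S0 \<union> S) (mod_depth p q) (set (glines g) \<union> anc_block (p + q) N (wr g)) UNIV A"
    by (rule impl_mono[OF A(1)]) (use sub in \<open>auto simp: gg\<close>)
  moreover have "A \<psi> = app g \<psi>" if "supp (\<lambda>y. \<forall>l\<ge>N. \<not> y l) \<psi>" for \<psi>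
    unfolding gg by (rule A(2), rule supp_weaken[OF that]) (auto simp: blk_def ge)
  ultimately show ?thesis by blast
next
  case False
  then have q0: "qac0_gate g" using g(2) by (simp add: qaccq_gate_def)
  have "gin q (S0 \<union> S) (set (glines g) \<union> anc_block (p + q) N (wr g)) UNIV g"
    using g q0 by (cases g) (auto simp: gin_def gok_def gate_wf_def qac0_gate_def)
  then have "impl q (S0 \<union> S) 1 (set (glines g) \<union> anc_block (p + q) N (wr g)) UNIV (run [g])"
    by (intro impl_layer) (auto simp: pdisj_def)
  then have "impl q (S0 \<union> S) (mod_depth p q) (set (glines g) \<union> anc_block (p + q) N (wr g)) UNIV (run [g])"
    by (rule impl_mono) (auto simp: mod_depth_def)
  then show ?thesis by (intro exI[of _ "run [g]"]) simp
qed

lemma app_zero_supp: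
  assumes "\<not> is_orc g" "wr g < N" "supp (\<lambda>y. \<forall>l\<ge>N. \<not> y l) \<psi>"
  shows "supp (\<lambda>y. \<forall>l\<ge>N. \<not> y l) (app g \<psi>)"
  using run_supp[OF assms(3), of "{..<N}" "[g]"] assms by (auto simp: indep_def)

lemma run_zero_supp:
  assumes "\<And>g. g \<in> set gs \<Longrightarrow> \<not> is_orc g \<and> wr g < N" "supp (\<lambda>y. \<forall>l\<ge>N. \<not> y l) \<psi>"
  shows "supp (\<lambda>y. \<forall>l\<ge>N. \<not> y l) (run gs \<psi>)"
  by (rule run_supp[OF assms(2), of "{..<N}"]) (use assms(1) in \<open>auto simp: indep_def\<close>)

lemma qaccq_not_orc: "qaccq_gate r g \<Longrightarrow> \<not> is_orc g"
  by (cases g) (auto simp: qaccq_gate_def qac0_gate_def)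

context mod_gates
begin

lemma layer_simulation:
  assumes "pdisj gs"
    and "\<And>g. g \<in> set gs \<Longrightarrow> gate_wf (\<lambda>_. 0) N g \<and> qaccq_gate p g \<and> (\<forall>U i. g = OneQ U i \<longrightarrow> U \<in> S0)"
  shows "\<exists>A. impl q (S0 \<union> S) (mod_depth p q) (\<Union>g\<in>set gs. set (glines g) \<union> anc_block (p + q) N (wr g)) UNIV A \<and>
    (\<forall>\<psi>. supp (\<lambda>y. \<forall>l\<ge>N. \<not> y l) \<psi> \<longrightarrow> A \<psi> = run gs \<psi>)"
  using assms
proof (induction gs)
  case Nil
  have "impl q (S0 \<union> S) (mod_depth p q) {} UNIV (\<lambda>\<psi>. \<psi>)" by (rule impl_mono[OF impl_id]) auto
  then show ?case by auto
next
  case (Cons g gs)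
  let ?L = "\<lambda>g. set (glines g) \<union> anc_block (p + q) N (wr g)"
  have pd: "pdisj gs" and dj: "\<And>h. h \<in> set gs \<Longrightarrow> set (glines g) \<inter> set (glines h) = {}"
    using Cons.prems(1) by (auto simp: pdisj_def)
  obtain B where B: "impl q (S0 \<union> S) (mod_depth p q) (\<Union>g\<in>set gs. ?L g) UNIV B"
    "\<And>\<psi>. supp (\<lambda>y. \<forall>l\<ge>N. \<not> y l) \<psi> \<Longrightarrow> B \<psi> = run gs \<psi>"
    using Cons.IH[OF pd] Cons.prems(2) by auto
  obtain A where A: "impl q (S0 \<union> S) (mod_depth p q) (?L g) UNIV A"
    "\<And>\<psi>. supp (\<lambda>y. \<forall>l\<ge>N. \<not> y l) \<psi> \<Longrightarrow> A \<psi> = app g \<psi>"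
    using gate_simulation[of N g S0] Cons.prems(2)[of g] by auto
  have no: "\<not> is_orc h" "\<And>l. l \<in> set (glines h) \<Longrightarrow> l < N" if "h \<in> set (g # gs)" for h
    using Cons.prems(2)[OF that] qaccq_not_orc by (auto simp: gate_wf_def)
  \<comment> \<open>Original lines lie below \<open>N\<close> and work lines above; original lines
    are disjoint by assumption, work lines because the targets differ.\<close>
  have "?L g \<inter> ?L h = {}" if h: "h \<in> set gs" for h
  proof -
    have ne: "wr g \<noteq> wr h" using wr_in[of g] wr_in[of h] no(1)[of g] no(1)[of h] dj[OF h] h by auto
    have "N \<le> l" if "l \<in> anc_block (p + q) N t" for l t using that by (auto simp: anc_block_def anc_def)
    then have "set (glines f) \<inter> anc_block (p + q) N t = {}" if "f \<in> set (g # gs)" for f t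
      using no(2)[OF that] by (meson disjoint_iff not_le)
    moreover have "anc_block (p + q) N (wr g) \<inter> anc_block (p + q) N (wr h) = {}"
      using ne by (auto simp: anc_block_def)
    ultimately show ?thesis using dj[OF h] h by (auto simp: Int_Un_distrib Int_Un_distrib2 Int_commute)
  qed
  then have "?L g \<inter> (\<Union>g\<in>set gs. ?L g) = {}" by blast
  from impl_par[OF A(1) B(1) this]
  have "impl q (S0 \<union> S) (mod_depth p q) (\<Union>g\<in>set (g # gs). ?L g) UNIV (\<lambda>\<psi>. B (A \<psi>))" by simp
  moreover have "B (A \<psi>) = run (g # gs) \<psi>" if "supp (\<lambda>y. \<forall>l\<ge>N. \<not> y l) \<psi>" for \<psi>
  proof -
    have "wr g < N" using no[of g] wr_in[of g] by auto
    then have "supp (\<lambda>y. \<forall>l\<ge>N. \<not> y l) (app g \<psi>)" using no(1)[of g] that by (intro app_zero_supp) auto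
    then show ?thesis using A(2)[OF that] B(2) by simp
  qed
  ultimately show ?case by blast
qed

text \<open>The simulated layer has the same output as the original one, whose gates write only
  below \<open>N\<close>. The work lines are therefore zero again and serve the next layer, so the
  width does not grow with the depth.\<close>

lemma circuit_simulation:
  assumes "\<And>L. L \<in> set C \<Longrightarrow> layer_wf (\<lambda>_. 0) N L \<and>
     (\<forall>g\<in>set (layer_gates L). qaccq_gate p g \<and> (\<forall>U i. g = OneQ U i \<longrightarrow> U \<in> S0))"
  shows "\<exists>A. impl q (S0 \<union> S) (length C * mod_depth p q) {..<N + anc_count (p + q) N} UNIV A \<and>
    (\<forall>\<psi>. supp (\<lambda>y. \<forall>l\<ge>N. \<not> y l) \<psi> \<longrightarrow> A \<psi> = run (concat (map layer_gates C)) \<psi>)"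
  using assms
proof (induction C)
  case Nil
  show ?case using impl_id[of q "S0 \<union> S"] by (intro exI[of _ "\<lambda>\<psi>. \<psi>"]) simp
next
  case (Cons L C)
  let ?M = "{..<N + anc_count (p + q) N}"
  obtain B where B: "impl q (S0 \<union> S) (length C * mod_depth p q) ?M UNIV B"
    "\<And>\<psi>. supp (\<lambda>y. \<forall>l\<ge>N. \<not> y l) \<psi> \<Longrightarrow> B \<psi> = run (concat (map layer_gates C)) \<psi>"
    using Cons.IH Cons.prems by (metis list.set_intros(2))
  have L: "pdisj (layer_gates L)" "\<And>g. g \<in> set (layer_gates L) \<Longrightarrow> gate_wf (\<lambda>_. 0) N g \<and> qaccq_gate p g \<and>
     (\<forall>U i. g = OneQ U i \<longrightarrow> U \<in> S0)"
    using Cons.prems[of L] by (auto simp: layer_wf_pdisj)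
  obtain A where A: "impl q (S0 \<union> S) (mod_depth p q)
       (\<Union>g\<in>set (layer_gates L). set (glines g) \<union> anc_block (p + q) N (wr g)) UNIV A"
    "\<And>\<psi>. supp (\<lambda>y. \<forall>l\<ge>N. \<not> y l) \<psi> \<Longrightarrow> A \<psi> = run (layer_gates L) \<psi>"
    using layer_simulation[OF L] by blast
  have no: "\<not> is_orc g \<and> wr g < N \<and> set (glines g) \<subseteq> {..<N}" if "g \<in> set (layer_gates L)" for g
    using L(2)[OF that] qaccq_not_orc wr_in by (auto simp: gate_wf_def)
  have "(\<Union>g\<in>set (layer_gates L). set (glines g) \<union> anc_block (p + q) N (wr g)) \<subseteq> ?M"
  proof (intro UN_least Un_least)
    fix g assume "g \<in> set (layer_gates L)"
    from no[OF this] show "set (glines g) \<subseteq> ?M" "anc_block (p + q) N (wr g) \<subseteq> ?M"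
      by (auto intro!: anc_block_less)
  qed
  then have "impl q (S0 \<union> S) (mod_depth p q) ?M UNIV A" by (intro impl_subset[OF A(1)]) auto
  from impl_seq[OF this B(1)]
  have "impl q (S0 \<union> S) (length (L # C) * mod_depth p q) ?M UNIV (\<lambda>\<psi>. B (A \<psi>))" by simp
  moreover have "B (A \<psi>) = run (concat (map layer_gates (L # C))) \<psi>" if "supp (\<lambda>y. \<forall>l\<ge>N. \<not> y l) \<psi>" for \<psi>
  proof -
    have "supp (\<lambda>y. \<forall>l\<ge>N. \<not> y l) (run (layer_gates L) \<psi>)"
      using no that by (intro run_zero_supp) auto
    then show ?thesis using A(2)[OF that] B(2) by simp
  qed
  ultimately show ?case by blast
qed

end

section \<open>Families and reducibility\<close>

text \<open>Without the additive constant the bound is directly closed under sums and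
  products.\<close>

lemma poly_bounded_iff: "poly_bounded a \<longleftrightarrow> (\<exists>c k. \<forall>n. a n \<le> c * (n + 1) ^ k)"
proof
  assume "poly_bounded a"
  then obtain c k where a: "\<And>n. a n \<le> c * n ^ k + c" by (auto simp: poly_bounded_def)
  have "a n \<le> (2 * c) * (n + 1) ^ k" for n
  proof -
    have "c * n ^ k \<le> c * (n + 1) ^ k" "c * 1 \<le> c * (n + 1) ^ k"
      by (intro mult_left_mono power_mono; simp)+
    then show ?thesis using a[of n] by linarith
  qed
  then show "\<exists>c k. \<forall>n. a n \<le> c * (n + 1) ^ k" by blast
next
  assume "\<exists>c k. \<forall>n. a n \<le> c * (n + 1) ^ k"
  then obtain c k where a: "\<And>n. a n \<le> c * (n + 1) ^ k" by auto
  have "a n \<le> (c * 2 ^ k) * n ^ k + c * 2 ^ k" for n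
  proof -
    have "(n + 1) ^ k \<le> 2 ^ k * n ^ k + 2 ^ k"
    proof (cases "n = 0")
      case False
      then have "(n + 1) ^ k \<le> (2 * n) ^ k" by (intro power_mono) auto
      then show ?thesis by (simp add: power_mult_distrib)
    next
      case True
      have "(1 :: nat) \<le> 2 ^ k" by simp
      then show ?thesis using True by (simp add: trans_le_add2)
    qed
    then have "c * (n + 1) ^ k \<le> c * (2 ^ k * n ^ k + 2 ^ k)" by (intro mult_left_mono) auto
    then show ?thesis using a[of n] by (simp add: algebra_simps)
  qed
  then show "poly_bounded a" unfolding poly_bounded_def by blast
qed

lemma poly_bounded_const: "poly_bounded (\<lambda>_. c)"
  unfolding poly_bounded_iff by (intro exI[of _ c] exI[of _ 0]) simp

lemma poly_bounded_id: "poly_bounded (\<lambda>n. n)"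
  unfolding poly_bounded_iff by (intro exI[of _ 1]) simp

lemma poly_bounded_mult:
  assumes "poly_bounded a" "poly_bounded b"
  shows "poly_bounded (\<lambda>n. a n * b n)"
proof -
  obtain c k d l where a: "\<And>n. a n \<le> c * (n + 1) ^ k" and b: "\<And>n. b n \<le> d * (n + 1) ^ l"
    using assms unfolding poly_bounded_iff by blast
  have "a n * b n \<le> (c * d) * (n + 1) ^ (k + l)" for n
    using mult_mono[OF a[of n] b[of n]] by (simp add: power_add mult_ac)
  then show ?thesis unfolding poly_bounded_iff by blast
qed

lemma poly_bounded_add:
  assumes "poly_bounded a" "poly_bounded b"
  shows "poly_bounded (\<lambda>n. a n + b n)"
proof -
  obtain c k d l where a: "\<And>n. a n \<le> c * (n + 1) ^ k" and b: "\<And>n. b n \<le> d * (n + 1) ^ l"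
    using assms unfolding poly_bounded_iff by blast
  have "a n + b n \<le> (c + d) * (n + 1) ^ (k + l)" for n
  proof -
    have "c * (n + 1) ^ k \<le> c * (n + 1) ^ (k + l)" "d * (n + 1) ^ l \<le> d * (n + 1) ^ (k + l)"
      by (intro mult_left_mono power_increasing; simp)+
    then show ?thesis using a[of n] b[of n] unfolding distrib_right by linarith
  qed
  then show ?thesis unfolding poly_bounded_iff by blast
qed

lemma poly_bounded_anc_count: "poly_bounded w \<Longrightarrow> poly_bounded (\<lambda>n. anc_count c (w n))"
  unfolding anc_count_def power2_eq_square
  by (intro poly_bounded_mult poly_bounded_add poly_bounded_const)

lemma circ_mat_oracle:
  assumes "Y \<in> states N" "X \<in> states N"
  shows "circ_mat G N [GLayer [Orc n [0..<N]]] Y X = G n Y X"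
proof -
  have m: "map ((!) Z) [0..<N] = Z" if "Z \<in> states N" for Z using that map_nth[of Z] by (simp add: states_def)
  have "circ_mat G N [GLayer [Orc n [0..<N]]] Y X = (\<Sum>z\<in>states N. if z = Y then G n Y X else 0)"
    unfolding circ_mat.simps op_mult_def
    by (intro sum.cong) (auto simp: op_id_def layer_mat_def m assms)
  then show ?thesis using assms finite_states by (simp add: sum.delta)
qed

text \<open>One oracle call on all lines is the entire reduction circuit: depth 1 and no one-qubit
  gate types. The lines of \<open>G\<close> beyond those of \<open>F\<close> become the work
  bits.\<close>

lemma reducible_by_oracle:
  assumes "poly_bounded k" "\<And>n. wG n = wF n + k n" "\<And>n. z n \<in> states (k n)"
    and "\<And>n x y. x \<in> states (wF n) \<Longrightarrow> y \<in> states (wF n) \<Longrightarrow> F n y x = G n (y @ z n) (x @ z n)"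
  shows "qac0_reducible wF F wG G"
  unfolding qac0_reducible_def
proof (intro exI[of _ k] exI[of _ 1] exI[of _ "{}"] conjI allI assms(1))
  fix n
  let ?C = "[GLayer [Orc n [0..<wF n + k n]]]"
  have "circ_ok (\<lambda>g. qac0_gate g \<or> (\<exists>m ls. g = Orc m ls)) wG (wF n + k n) 1 {} ?C"
    using assms(2) by (auto simp: circ_ok_def layer_wf_def gate_wf_def)
  moreover have "F n y x = circ_mat G (wF n + k n) ?C (y @ z n) (x @ z n)"
    if "x \<in> states (wF n)" "y \<in> states (wF n)" for x y
    using assms(3)[of n] that by (subst circ_mat_oracle) (auto simp: states_def assms(4))
  ultimately show "\<exists>C. circ_ok (\<lambda>g. qac0_gate g \<or> (\<exists>m ls. g = Orc m ls)) wG (wF n + k n) 1 {} C \<and>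
          (\<forall>x\<in>states (wF n). \<forall>y\<in>states (wF n). \<exists>z\<in>states (k n).
              F n y x = circ_mat G (wF n + k n) C (y @ z) (x @ z))"
    using assms(3)[of n] by blast
qed simp

lemma impl_circuit:
  assumes "impl q S d {..<N} UNIV A" "\<And>U. U \<in> S \<Longrightarrow> unitary2 U"
  shows "\<exists>C. circ_ok (qaccq_gate q) (\<lambda>_. 0) N d S C \<and> A = run (concat (map layer_gates C))"
proof -
  obtain C where C: "length C = d" "A = run (concat C)"
     "\<forall>gs\<in>set C. pdisj gs \<and> (\<forall>g\<in>set gs. gin q S {..<N} UNIV g)"
    using assms(1) unfolding impl_def by blast
  have g: "gate_wf (\<lambda>_. 0) N g \<and> qaccq_gate q g \<and> (\<forall>U i. g = OneQ U i \<longrightarrow> U \<in> S)"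
    if "gin q S {..<N} UNIV g" for g
    using that assms(2) by (cases g) (auto simp: gin_def gok_def gate_wf_def qaccq_gate_def qac0_gate_def)
  have "circ_ok (qaccq_gate q) (\<lambda>_. 0) N d S (map GLayer C)"
    unfolding circ_ok_def layer_wf_pdisj
  proof (intro conjI ballI)
    fix L assume "L \<in> set (map GLayer C)"
    then obtain gs where gs: "gs \<in> set C" "L = GLayer gs" by auto
    then have "gin q S {..<N} UNIV h" if "h \<in> set gs" for h using C(3) that by blast
    note h = g[OF this]
    show "pdisj (layer_gates L)" using C(3) gs by simp
    fix h assume "h \<in> set (layer_gates L)"
    then show "gate_wf (\<lambda>_. 0) N h" "qaccq_gate q h" "\<forall>U i. h = OneQ U i \<longrightarrow> U \<in> S"
      using h[of h] gs(2) by auto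
  qed (simp add: C(1))
  moreover have "map layer_gates (map GLayer C) = C" by (simp add: comp_def)
  ultimately show ?thesis using C(2) by (intro exI[of _ "map GLayer C"]) simp
qed

lemma circ_ok_no_oracle:
  assumes "circ_ok (qaccq_gate q) (\<lambda>_. 0) N d S C" "L \<in> set C"
  shows "layer_wf (\<lambda>_. 0) N L \<and> (\<forall>g\<in>set (layer_gates L). \<not> is_orc g)"
  using assms qaccq_not_orc by (auto simp: circ_ok_def)

lemma gadget_gate_set: "p \<ge> 2 \<Longrightarrow> q \<ge> 2 \<Longrightarrow> \<exists>S. finite S \<and> mod_gates p q S"
proof -
  assume pq: "p \<ge> 2" "q \<ge> 2"
  define B where "B = Vm ` {..<p + q} \<union> (\<lambda>j. ph (rt q ^ j)) ` {..q} \<union> {ph (rt p)}"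
  have u: "unitary2 U \<and> unitary2 (adj U)" if "U \<in> B" for U
    using that unitary2_Vm unitary2_ph by (auto simp: B_def rt_def norm_power)
  \<comment> \<open>Adjoints are added to obtain \<open>usys\<close>; a second round is unnecessary
    because \<open>adj\<close> is an involution.\<close>
  have "mod_gates p q (B \<union> adj ` B)"
    by unfold_locales (use pq u in \<open>auto simp: usys_def B_def\<close>)
  moreover have "finite (B \<union> adj ` B)" by (simp add: B_def)
  ultimately show ?thesis by blast
qed

lemma QACCq_simulation:
  assumes pq: "p \<ge> 2" "q \<ge> 2" and F: "QACCq p w F"
  shows "\<exists>w' G. QACCq q w' G \<and> qac0_reducible w F w' G"
proof -
  obtain a d S0 where a: "poly_bounded a" "finite S0" and w: "\<And>n. w n = n + a n"
    and "\<forall>n. \<exists>C. circ_ok (qaccq_gate p) (\<lambda>_. 0) (w n) d S0 C \<and>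
             (\<forall>x\<in>states (w n). \<forall>y\<in>states (w n). F n y x = circ_mat (\<lambda>_ _ _. 0) (w n) C y x)"
    using F unfolding QACCq_def circ_class_def by blast
  from choice[OF this(4)] obtain C where C: "\<And>n. circ_ok (qaccq_gate p) (\<lambda>_. 0) (w n) d S0 (C n)"
    and FC: "\<And>n x y. x \<in> states (w n) \<Longrightarrow> y \<in> states (w n) \<Longrightarrow> F n y x = circ_mat (\<lambda>_ _ _. 0) (w n) (C n) y x"
    by blast
  obtain S where S: "finite S" "mod_gates p q S" using gadget_gate_set[OF pq] by blast
  interpret mod_gates p q S by (rule S)
  \<comment> \<open>\<open>S0\<close> may contain matrices that are not unitary. They occur in no
    well-formed gate, and are dropped because \<open>impl_circuit\<close> asks for a unitary gate
    set.\<close>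
  define S1 where "S1 = {U \<in> S0. unitary2 U}"
  define k where "k n = anc_count (p + q) (w n)" for n
  have "\<forall>n. \<exists>C'. circ_ok (qaccq_gate q) (\<lambda>_. 0) (w n + k n) (d * mod_depth p q) (S1 \<union> S) C' \<and>
     (\<forall>\<psi>. supp (\<lambda>y. \<forall>l\<ge>w n. \<not> y l) \<psi> \<longrightarrow>
        run (concat (map layer_gates C')) \<psi> = run (concat (map layer_gates (C n))) \<psi>)"
  proof
    fix n
    have "layer_wf (\<lambda>_. 0) (w n) L \<and> (\<forall>g\<in>set (layer_gates L). qaccq_gate p g \<and> (\<forall>U i. g = OneQ U i \<longrightarrow> U \<in> S1))"
      if "L \<in> set (C n)" for L
      using C[of n] that by (fastforce simp: circ_ok_def S1_def layer_wf_pdisj gate_wf_def)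
    from circuit_simulation[OF this]
    obtain A where A: "impl q (S1 \<union> S) (length (C n) * mod_depth p q) {..<w n + k n} UNIV A"
      "\<And>\<psi>. supp (\<lambda>y. \<forall>l\<ge>w n. \<not> y l) \<psi> \<Longrightarrow> A \<psi> = run (concat (map layer_gates (C n))) \<psi>"
      unfolding k_def by blast
    have "impl q (S1 \<union> S) (d * mod_depth p q) {..<w n + k n} UNIV A"
      by (rule impl_mono[OF A(1)]) (use C[of n] in \<open>auto simp: circ_ok_def\<close>)
    moreover have "unitary2 U" if "U \<in> S1 \<union> S" for U using that usys by (auto simp: S1_def usys_def)
    ultimately obtain C' where "circ_ok (qaccq_gate q) (\<lambda>_. 0) (w n + k n) (d * mod_depth p q) (S1 \<union> S) C'"
      "A = run (concat (map layer_gates C'))" using impl_circuit[of q "S1 \<union> S"] by blast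
    then show "\<exists>C'. circ_ok (qaccq_gate q) (\<lambda>_. 0) (w n + k n) (d * mod_depth p q) (S1 \<union> S) C' \<and>
     (\<forall>\<psi>. supp (\<lambda>y. \<forall>l\<ge>w n. \<not> y l) \<psi> \<longrightarrow>
        run (concat (map layer_gates C')) \<psi> = run (concat (map layer_gates (C n))) \<psi>)" using A(2) by blast
  qed
  from choice[OF this] obtain C' where C': "\<And>n. circ_ok (qaccq_gate q) (\<lambda>_. 0) (w n + k n) (d * mod_depth p q) (S1 \<union> S) (C' n)"
    and R: "\<And>n \<psi>. supp (\<lambda>y. \<forall>l\<ge>w n. \<not> y l) \<psi> \<Longrightarrow>
        run (concat (map layer_gates (C' n))) \<psi> = run (concat (map layer_gates (C n))) \<psi>"
    by blast
  \<comment> \<open>\<open>G\<close> is the exact matrix of the simulating circuit on all its lines,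
    so membership in the class is immediate; agreement with \<open>F\<close> is needed only for zero
    work bits.\<close>
  define G where "G n = circ_mat (\<lambda>_ _ _. 0) (w n + k n) (C' n)" for n
  have pk: "poly_bounded k" unfolding k_def w
    by (intro poly_bounded_anc_count poly_bounded_add poly_bounded_id a(1))
  have "QACCq q (\<lambda>n. w n + k n) G"
    unfolding QACCq_def circ_class_def
  proof (intro exI[of _ "\<lambda>n. a n + k n"] exI[of _ "d * mod_depth p q"] exI[of _ "S1 \<union> S"] conjI allI)
    show "poly_bounded (\<lambda>n. a n + k n)" by (intro poly_bounded_add a(1) pk)
    show "finite (S1 \<union> S)" using a(2) S(1) by (simp add: S1_def)
    show "w n + k n = n + (a n + k n)" for n by (simp add: w)
    show "\<exists>C. circ_ok (qaccq_gate q) (\<lambda>_. 0) (w n + k n) (d * mod_depth p q) (S1 \<union> S) C \<and>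
       (\<forall>x\<in>states (w n + k n). \<forall>y\<in>states (w n + k n). G n y x = circ_mat (\<lambda>_ _ _. 0) (w n + k n) C y x)" for n
      using C' by (auto simp: G_def)
  qed
  moreover have "qac0_reducible w F (\<lambda>n. w n + k n) G"
  proof (rule reducible_by_oracle[OF pk])
    show "replicate (k n) False \<in> states (k n)" for n by (simp add: states_def)
    fix n x y assume xy: "x \<in> states (w n)" "y \<in> states (w n)"
    have e: "ext (v @ replicate (k n) False) = ext v" for v by (auto simp: ext_def fun_eq_iff nth_append)
    have xy': "x @ replicate (k n) False \<in> states (w n + k n)" "y @ replicate (k n) False \<in> states (w n + k n)"
      using xy by (auto simp: states_def)
    let ?\<delta> = "\<lambda>v. if v = ext x then 1 else 0 :: complex"
    have "supp (\<lambda>y. \<forall>l\<ge>w n. \<not> y l) ?\<delta>" using xy by (auto simp: supp_def ext_def states_def)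
    then have "run (concat (map layer_gates (C n))) ?\<delta> (ext y) = run (concat (map layer_gates (C' n))) ?\<delta> (ext y)"
      using R by simp
    moreover have "F n y x = run (concat (map layer_gates (C n))) ?\<delta> (ext y)"
      using circ_mat_amplitude[OF circ_ok_no_oracle[OF C] xy(2,1)] FC[OF xy] by simp
    moreover have "G n (y @ replicate (k n) False) (x @ replicate (k n) False) =
        run (concat (map layer_gates (C' n))) ?\<delta> (ext y)"
      unfolding G_def using circ_mat_amplitude[OF circ_ok_no_oracle[OF C'] xy'(2,1)] by (simp add: e)
    ultimately show "F n y x = G n (y @ replicate (k n) False) (x @ replicate (k n) False)" by simp
  qed simp
  ultimately show ?thesis by blast
qed

theorem mainTheorem7:
  fixes q :: nat
  assumes "q \<ge> 2"
  shows "(\<forall>w F. QACC w F \<longrightarrow> (\<exists>w' G. QACCq q w' G \<and> qac0_reducible w F w' G)) \<and>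
         (\<forall>w F. QACCq q w F \<longrightarrow> (\<exists>w' G. QACC w' G \<and> qac0_reducible w F w' G))"
proof (intro conjI allI impI)
  fix w F assume "QACC w F"
  then obtain p where "p \<ge> 2" "QACCq p w F" by (auto simp: QACC_def)
  then show "\<exists>w' G. QACCq q w' G \<and> qac0_reducible w F w' G" using QACCq_simulation assms by blast
next
  fix w F assume "QACCq q w F"
  then have "QACC w F" using assms by (auto simp: QACC_def)
  moreover have "qac0_reducible w F w F"
    by (rule reducible_by_oracle[where k = "\<lambda>_. 0" and z = "\<lambda>_. []"])
      (auto simp: states_def intro: poly_bounded_const)
  ultimately show "\<exists>w' G. QACC w' G \<and> qac0_reducible w F w' G" by blast
qed

end
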